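(* Let $(\overline V,\overline\sigma)=((V_i)_{1\le i\le r};(\sigma_{i,j})_{i\le j})$ be a braided system in an additive monoidal category $\mathcal C$. Let $(M,\overline\rho)$ be a right and $(N,\overline\lambda)$ a left $(\overline V,\overline\sigma)$-module. For $n\ge1$, define morphisms from $M\otimes T(\overline V)_n^{\rightarrow}\otimes N$ to $M\otimes T(\overline V)_{n-1}^{\rightarrow}\otimes N$ by $$({}^{\rho}d)_n=(\rho\otimes\mathrm{Id}_{T(\overline V)_{n-1}^{\rightarrow}\otimes N})(\mathrm{Id}_M\otimes\Delta^{-\overline\sigma}_{1,n-1}\otimes\mathrm{Id}_N),$$ $$(d^{\lambda})_n=(-1)^{n-1}(\mathrm{Id}_{M\otimes T(\overline V)_{n-1}^{\rightarrow}}\otimes\lambda)(\mathrm{Id}_M\otimes\Delta^{-\overline\sigma}_{n-1,1}\otimes\mathrm{Id}_N),$$ where $\Delta^{-\overline\sigma}_{p,q}$ is the multi-quantum shuffle coproduct of the braided system $(\overline V,-\overline\sigma)$. Then these families form a bidifferential with coefficients in $M$ and $N$, i.e. for all $n>1$ $$({}^{\rho}d)_{n-1}({}^{\rho}d)_n=0,\qquad (d^{\lambda})_{n-1}(d^{\lambda})_n=0,\qquad (d^{\lambda})_{n-1}({}^{\rho}d)_n+({}^{\rho}d)_{n-1}(d^{\lambda})_n=0.$$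
   Context: Monoidal categories are strict; an additive monoidal category is one that is additive with tensor product additive in each variable. Juxtaposition is composition, $\mathrm{Id}_i=\mathrm{Id}_{V_i}$. A rank $r$ braided system is an ordered family $V_1,\dots,V_r$ with morphisms $\sigma_{i,j}\colon V_i\otimes V_j\to V_j\otimes V_i$, $i\le j$ (not necessarily invertible), satisfying $(\sigma_{j,k}\otimes \mathrm{Id}_i)(\mathrm{Id}_j\otimes\sigma_{i,k})(\sigma_{i,j}\otimes\mathrm{Id}_k)=(\mathrm{Id}_k\otimes\sigma_{i,j})(\sigma_{i,k}\otimes\mathrm{Id}_j)(\mathrm{Id}_i\otimes\sigma_{j,k})$ on $V_i\otimes V_j\otimes V_k$, $i\le j\le k$. Then $(\overline V,-\overline\sigma)$, with $(-\overline\sigma)_{i,j}=-\sigma_{i,j}$, is also a braided system. Right module: an object $M$ with $\rho_i\colon M\otimes V_i\to M$ such that $\rho_j(\rho_i\otimes\mathrm{Id}_j)=\rho_i(\rho_j\otimes\mathrm{Id}_i)(\mathrm{Id}_M\otimes\sigma_{i,j})$ for $i\le j$. Left module: an object $N$ with $\lambda_i\colon V_i\otimes N\to N$ such that $\lambda_i(\mathrm{Id}_i\otimes\lambda_j)=\lambda_j(\mathrm{Id}_j\otimes\lambda_i)(\sigma_{i,j}\otimes\mathrm{Id}_N)$ for $i\le j$. With $V:=V_1\oplus\cdots\oplus V_r$, the $\rho_i$ (resp. $\lambda_i$) assemble into $\rho\colon M\otimes V\to M$ (resp. $\lambda\colon V\otimes N\to N$). $T(\overline V)_n^{\rightarrow}$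 is the direct sum of all ordered tensor products $V_{k_1}\otimes\cdots\otimes V_{k_n}$, $k_1\le\cdots\le k_n$ (so $T(\overline V)_0^{\rightarrow}=\mathbf I$, $T(\overline V)_1^{\rightarrow}=V$). Multi-quantum shuffle coproduct: $Sh_{p,q}\subset S_{p+q}$ is the set of $\theta$ with $\theta(1)<\cdots<\theta(p)$ and $\theta(p+1)<\cdots<\theta(p+q)$. For $\theta\in S_n$, $B_\theta$ is the positive braid $\sigma_{i_1}\cdots\sigma_{i_k}$ obtained from any shortest expression $\theta=s_{i_1}\cdots s_{i_k}$. For a braided system $(\overline V,\overline\tau)$, positive braids act partially on summands of $V^{\otimes n}$ (rightmost generator first): $\sigma_i$ acts on $V_{k_1}\otimes\cdots\otimes V_{k_n}$ by $\tau_{k_i,k_{i+1}}$ at positions $i,i+1$, defined when $k_i\le k_{i+1}$; this is written $b\mapsto b^{\overline\tau}$. Then $\Delta^{\overline\tau}_{p,q}:=\sum_{\theta\in Sh_{p,q}}(B_{\theta^{-1}})^{\overline\tau}\colon T(\overline V)^{\rightarrow}_{p+q}\to T(\overline V)^{\rightarrow}_p\otimes T(\overline V)^{\rightarrow}_q$ (well defined). *)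

theory Defs
  imports "HOL-Algebra.Group" "HOL-Algebra.FiniteProduct" "HOL-Combinatorics.Permutations"
begin

section \<open>Additive strict monoidal categories\<close>

record ('o, 'm) moncat =
  Obj :: "'o set"
  Arr :: "'m set"
  Dom :: "'m \<Rightarrow> 'o"
  Cod :: "'m \<Rightarrow> 'o"
  ident :: "'o \<Rightarrow> 'm"
  comp :: "'m \<Rightarrow> 'm \<Rightarrow> 'm" (infixr "\<cdot>\<index>" 65)
  tobj :: "'o \<Rightarrow> 'o \<Rightarrow> 'o" (infixr "\<otimes>\<^sub>o\<index>" 70)
  tarr :: "'m \<Rightarrow> 'm \<Rightarrow> 'm" (infixr "\<otimes>\<^sub>a\<index>" 70)
  unit :: 'o
  Add :: "'m \<Rightarrow> 'm \<Rightarrow> 'm"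
  Zero :: "'o \<Rightarrow> 'o \<Rightarrow> 'm"

context
  fixes C :: "('o, 'm) moncat" (structure)
begin

definition Hom :: "'o \<Rightarrow> 'o \<Rightarrow> 'm set" where
  "Hom X Y = {f \<in> Arr C. Dom C f = X \<and> Cod C f = Y}"

text \<open>The additive structure of a hom-set, as a (multiplicatively written) group of HOL-Algebra:
  sums of arrows are \<^const>\<open>finprod\<close>, negatives are \<^const>\<open>m_inv\<close>, integer multiples are powers.\<close>

definition hom_group :: "'o \<Rightarrow> 'o \<Rightarrow> 'm monoid" where
  "hom_group X Y = \<lparr>carrier = Hom X Y, monoid.mult = Add C, one = Zero C X Y\<rparr>"

definition arr_sum :: "'o \<Rightarrow> 'o \<Rightarrow> ('i \<Rightarrow> 'm) \<Rightarrow> 'i set \<Rightarrow> 'm" where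
  "arr_sum X Y f I = finprod (hom_group X Y) f I"

definition arr_neg :: "'o \<Rightarrow> 'o \<Rightarrow> 'm \<Rightarrow> 'm" where
  "arr_neg X Y f = m_inv (hom_group X Y) f"

definition arr_scale :: "'o \<Rightarrow> 'o \<Rightarrow> int \<Rightarrow> 'm \<Rightarrow> 'm" where
  "arr_scale X Y z f = f [^]\<^bsub>hom_group X Y\<^esub> z"

definition is_biproduct ::
  "'i set \<Rightarrow> ('i \<Rightarrow> 'o) \<Rightarrow> 'o \<Rightarrow> ('i \<Rightarrow> 'm) \<Rightarrow> ('i \<Rightarrow> 'm) \<Rightarrow> bool" where
  "is_biproduct I X S incl proj \<longleftrightarrow>
     finite I \<and> S \<in> Obj C \<and>
     (\<forall>i\<in>I. X i \<in> Obj C \<and> incl i \<in> Hom (X i) S \<and> proj i \<in> Hom S (X i)) \<and>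
     (\<forall>i\<in>I. \<forall>j\<in>I. proj i \<cdot> incl j = (if i = j then ident C (X i) else Zero C (X j) (X i))) \<and>
     arr_sum S S (\<lambda>i. incl i \<cdot> proj i) I = ident C S"

end

locale strict_monoidal_category =
  fixes C :: "('o, 'm) moncat" (structure)
  assumes dom_obj: "f \<in> Arr C \<Longrightarrow> Dom C f \<in> Obj C"
    and cod_obj: "f \<in> Arr C \<Longrightarrow> Cod C f \<in> Obj C"
    and ident_hom: "X \<in> Obj C \<Longrightarrow> ident C X \<in> Hom C X X"
    and comp_hom: "\<lbrakk>f \<in> Hom C X Y; g \<in> Hom C Y Z\<rbrakk> \<Longrightarrow> g \<cdot> f \<in> Hom C X Z"
    and comp_assoc:
      "\<lbrakk>f \<in> Hom C W X; g \<in> Hom C X Y; h \<in> Hom C Y Z\<rbrakk> \<Longrightarrow> (h \<cdot> g) \<cdot> f = h \<cdot> (g \<cdot> f)"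
    and comp_ident_right: "f \<in> Hom C X Y \<Longrightarrow> f \<cdot> ident C X = f"
    and comp_ident_left: "f \<in> Hom C X Y \<Longrightarrow> ident C Y \<cdot> f = f"
    and unit_obj: "unit C \<in> Obj C"
    and tobj_obj: "\<lbrakk>X \<in> Obj C; Y \<in> Obj C\<rbrakk> \<Longrightarrow> X \<otimes>\<^sub>o Y \<in> Obj C"
    and tobj_assoc:
      "\<lbrakk>X \<in> Obj C; Y \<in> Obj C; Z \<in> Obj C\<rbrakk> \<Longrightarrow> (X \<otimes>\<^sub>o Y) \<otimes>\<^sub>o Z = X \<otimes>\<^sub>o (Y \<otimes>\<^sub>o Z)"
    and tobj_unit_left: "X \<in> Obj C \<Longrightarrow> unit C \<otimes>\<^sub>o X = X"
    and tobj_unit_right: "X \<in> Obj C \<Longrightarrow> X \<otimes>\<^sub>o unit C = X"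
    and tarr_hom:
      "\<lbrakk>f \<in> Hom C X Y; f' \<in> Hom C X' Y'\<rbrakk> \<Longrightarrow> f \<otimes>\<^sub>a f' \<in> Hom C (X \<otimes>\<^sub>o X') (Y \<otimes>\<^sub>o Y')"
    and tarr_ident:
      "\<lbrakk>X \<in> Obj C; Y \<in> Obj C\<rbrakk> \<Longrightarrow> ident C X \<otimes>\<^sub>a ident C Y = ident C (X \<otimes>\<^sub>o Y)"
    and tarr_comp:
      "\<lbrakk>f \<in> Hom C X Y; g \<in> Hom C Y Z; f' \<in> Hom C X' Y'; g' \<in> Hom C Y' Z'\<rbrakk>
        \<Longrightarrow> (g \<cdot> f) \<otimes>\<^sub>a (g' \<cdot> f') = (g \<otimes>\<^sub>a g') \<cdot> (f \<otimes>\<^sub>a f')"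
    and tarr_assoc:
      "\<lbrakk>f \<in> Arr C; g \<in> Arr C; h \<in> Arr C\<rbrakk> \<Longrightarrow> (f \<otimes>\<^sub>a g) \<otimes>\<^sub>a h = f \<otimes>\<^sub>a (g \<otimes>\<^sub>a h)"
    and tarr_unit_left: "f \<in> Arr C \<Longrightarrow> ident C (unit C) \<otimes>\<^sub>a f = f"
    and tarr_unit_right: "f \<in> Arr C \<Longrightarrow> f \<otimes>\<^sub>a ident C (unit C) = f"

locale additive_monoidal_category = strict_monoidal_category +
  assumes hom_comm_group:
      "\<lbrakk>X \<in> Obj C; Y \<in> Obj C\<rbrakk> \<Longrightarrow> comm_group (hom_group C X Y)"
    and comp_add_left:
      "\<lbrakk>f \<in> Hom C X Y; g \<in> Hom C Y Z; g' \<in> Hom C Y Z\<rbrakk>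
        \<Longrightarrow> Add C g g' \<cdot> f = Add C (g \<cdot> f) (g' \<cdot> f)"
    and comp_add_right:
      "\<lbrakk>f \<in> Hom C X Y; f' \<in> Hom C X Y; g \<in> Hom C Y Z\<rbrakk>
        \<Longrightarrow> g \<cdot> Add C f f' = Add C (g \<cdot> f) (g \<cdot> f')"
    and tarr_add_left:
      "\<lbrakk>f \<in> Hom C X Y; f' \<in> Hom C X Y; g \<in> Arr C\<rbrakk>
        \<Longrightarrow> Add C f f' \<otimes>\<^sub>a g = Add C (f \<otimes>\<^sub>a g) (f' \<otimes>\<^sub>a g)"
    and tarr_add_right:
      "\<lbrakk>f \<in> Arr C; g \<in> Hom C X Y; g' \<in> Hom C X Y\<rbrakk>
        \<Longrightarrow> f \<otimes>\<^sub>a Add C g g' = Add C (f \<otimes>\<^sub>a g) (f \<otimes>\<^sub>a g')"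
    \<comment> \<open>the case \<open>n = 0\<close> provides a zero object\<close>
    and finite_biproducts:
      "(\<And>i. i < n \<Longrightarrow> F i \<in> Obj C) \<Longrightarrow> \<exists>S incl proj. is_biproduct C {..<n::nat} F S incl proj"


section \<open>Shuffles and positive braids\<close>

definition Sh :: "nat \<Rightarrow> nat \<Rightarrow> (nat \<Rightarrow> nat) set" where
  "Sh p q = {\<theta>. \<theta> permutes {1..p+q} \<and>
                 strict_mono_on {1..p} \<theta> \<and> strict_mono_on {p+1..p+q} \<theta>}"

text \<open>A word \<open>[i\<^sub>1, \<dots>, i\<^sub>k]\<close> stands for the permutation \<open>s\<^bsub>i\<^sub>1\<^esub> \<circ> \<dots> \<circ> s\<^bsub>i\<^sub>k\<^esub>\<close> as well as
  for the positive braid \<open>\<sigma>\<^bsub>i\<^sub>1\<^esub> \<dots> \<sigma>\<^bsub>i\<^sub>k\<^esub>\<close>.\<close>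

definition word_perm :: "nat list \<Rightarrow> nat \<Rightarrow> nat" where
  "word_perm w = foldr (\<lambda>i f. transpose i (Suc i) \<circ> f) w id"

definition braid_word :: "nat \<Rightarrow> (nat \<Rightarrow> nat) \<Rightarrow> nat list" where
  "braid_word n \<theta> = (ARG_MIN length w. set w \<subseteq> {1..<n} \<and> word_perm w = \<theta>)"


section \<open>Braided systems and the multi-quantum shuffle coproduct\<close>

text \<open>A braided system of rank \<open>r\<close> is given by objects \<open>V i\<close> for \<open>1 \<le> i \<le> r\<close> and arrows
  \<open>\<sigma> i j\<close> for \<open>1 \<le> i \<le> j \<le> r\<close>; values at other indices are irrelevant.\<close>

context
  fixes C :: "('o, 'm) moncat" (structure)
begin

definition braided_system :: "nat \<Rightarrow> (nat \<Rightarrow> 'o) \<Rightarrow> (nat \<Rightarrow> nat \<Rightarrow> 'm) \<Rightarrow> bool" where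
  "braided_system r V \<sigma> \<longleftrightarrow>
     (\<forall>i\<in>{1..r}. V i \<in> Obj C) \<and>
     (\<forall>i\<in>{1..r}. \<forall>j\<in>{i..r}. \<sigma> i j \<in> Hom C (V i \<otimes>\<^sub>o V j) (V j \<otimes>\<^sub>o V i)) \<and>
     (\<forall>i\<in>{1..r}. \<forall>j\<in>{i..r}. \<forall>k\<in>{j..r}.
        (\<sigma> j k \<otimes>\<^sub>a ident C (V i)) \<cdot> (ident C (V j) \<otimes>\<^sub>a \<sigma> i k) \<cdot> (\<sigma> i j \<otimes>\<^sub>a ident C (V k)) =
        (ident C (V k) \<otimes>\<^sub>a \<sigma> i j) \<cdot> (\<sigma> i k \<otimes>\<^sub>a ident C (V j)) \<cdot> (ident C (V i) \<otimes>\<^sub>a \<sigma> j k))"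

definition neg_braiding :: "(nat \<Rightarrow> 'o) \<Rightarrow> (nat \<Rightarrow> nat \<Rightarrow> 'm) \<Rightarrow> nat \<Rightarrow> nat \<Rightarrow> 'm" where
  "neg_braiding V \<sigma> i j = arr_neg C (V i \<otimes>\<^sub>o V j) (V j \<otimes>\<^sub>o V i) (\<sigma> i j)"

definition right_module ::
  "nat \<Rightarrow> (nat \<Rightarrow> 'o) \<Rightarrow> (nat \<Rightarrow> nat \<Rightarrow> 'm) \<Rightarrow> 'o \<Rightarrow> (nat \<Rightarrow> 'm) \<Rightarrow> bool" where
  "right_module r V \<sigma> M \<rho> \<longleftrightarrow>
     M \<in> Obj C \<and>
     (\<forall>i\<in>{1..r}. \<rho> i \<in> Hom C (M \<otimes>\<^sub>o V i) M) \<and>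
     (\<forall>i\<in>{1..r}. \<forall>j\<in>{i..r}.
        \<rho> j \<cdot> (\<rho> i \<otimes>\<^sub>a ident C (V j)) =
        \<rho> i \<cdot> (\<rho> j \<otimes>\<^sub>a ident C (V i)) \<cdot> (ident C M \<otimes>\<^sub>a \<sigma> i j))"

definition left_module ::
  "nat \<Rightarrow> (nat \<Rightarrow> 'o) \<Rightarrow> (nat \<Rightarrow> nat \<Rightarrow> 'm) \<Rightarrow> 'o \<Rightarrow> (nat \<Rightarrow> 'm) \<Rightarrow> bool" where
  "left_module r V \<sigma> N lam \<longleftrightarrow>
     N \<in> Obj C \<and>
     (\<forall>i\<in>{1..r}. lam i \<in> Hom C (V i \<otimes>\<^sub>o N) N) \<and>
     (\<forall>i\<in>{1..r}. \<forall>j\<in>{i..r}.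
        lam i \<cdot> (ident C (V i) \<otimes>\<^sub>a lam j) =
        lam j \<cdot> (ident C (V j) \<otimes>\<^sub>a lam i) \<cdot> (\<sigma> i j \<otimes>\<^sub>a ident C N))"

definition tensor_list :: "(nat \<Rightarrow> 'o) \<Rightarrow> nat list \<Rightarrow> 'o" where
  "tensor_list V ks = foldr (\<lambda>k X. V k \<otimes>\<^sub>o X) ks (unit C)"

definition ordered_words :: "nat \<Rightarrow> nat \<Rightarrow> nat list set" where
  "ordered_words r n = {ks. length ks = n \<and> set ks \<subseteq> {1..r} \<and> sorted ks}"

text \<open>\<open>T n\<close> is the ordered tensor power of degree \<open>n\<close>, with the inclusions \<open>incl ks\<close> and projections
  \<open>proj ks\<close> of its summands. Direct sums being determined only up to isomorphism, such a choice is a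
  datum. The direct sum of the \<open>V i\<close> is \<open>T 1\<close>, the summand \<open>V i\<close> being indexed by \<open>[i]\<close>.\<close>

definition ordered_tensor_powers ::
  "nat \<Rightarrow> (nat \<Rightarrow> 'o) \<Rightarrow> (nat \<Rightarrow> 'o) \<Rightarrow> (nat list \<Rightarrow> 'm) \<Rightarrow> (nat list \<Rightarrow> 'm) \<Rightarrow> bool" where
  "ordered_tensor_powers r V T incl proj \<longleftrightarrow>
     (\<forall>n. is_biproduct C (ordered_words r n) (tensor_list V) (T n) incl proj) \<and>
     T 0 = unit C \<and> incl [] = ident C (unit C) \<and> proj [] = ident C (unit C)"

definition right_action :: 
  "nat \<Rightarrow> (nat \<Rightarrow> 'o) \<Rightarrow> (nat list \<Rightarrow> 'm) \<Rightarrow> 'o \<Rightarrow> (nat \<Rightarrow> 'm) \<Rightarrow> 'm" where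
  "right_action r T proj M \<rho> =
     arr_sum C (M \<otimes>\<^sub>o T 1) M (\<lambda>i. \<rho> i \<cdot> (ident C M \<otimes>\<^sub>a proj [i])) {1..r}"

definition left_action :: 
  "nat \<Rightarrow> (nat \<Rightarrow> 'o) \<Rightarrow> (nat list \<Rightarrow> 'm) \<Rightarrow> 'o \<Rightarrow> (nat \<Rightarrow> 'm) \<Rightarrow> 'm" where
  "left_action r T proj N lam =
     arr_sum C (T 1 \<otimes>\<^sub>o N) N (\<lambda>i. lam i \<cdot> (proj [i] \<otimes>\<^sub>a ident C N)) {1..r}"

text \<open>The generator \<open>\<sigma>\<^sub>i\<close> acts at the positions \<open>i\<close>, \<open>i + 1\<close>, counted from 1, i.e. at the list indices
  \<open>i - 1\<close>, \<open>i\<close>.\<close>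

definition generator_arr ::
  "(nat \<Rightarrow> 'o) \<Rightarrow> (nat \<Rightarrow> nat \<Rightarrow> 'm) \<Rightarrow> nat \<Rightarrow> nat list \<Rightarrow> 'm" where
  "generator_arr V \<tau> i ks =
     ident C (tensor_list V (take (i - 1) ks)) \<otimes>\<^sub>a \<tau> (ks ! (i - 1)) (ks ! i) \<otimes>\<^sub>a
     ident C (tensor_list V (drop (i + 1) ks))"

text \<open>The partial action of a positive braid, given by a word, on the summand of index \<open>ks\<close>: the index
  of the target summand together with the resulting arrow, or \<^const>\<open>None\<close> where undefined.\<close>

primrec braid_act ::
  "(nat \<Rightarrow> 'o) \<Rightarrow> (nat \<Rightarrow> nat \<Rightarrow> 'm) \<Rightarrow> nat list \<Rightarrow> nat list \<Rightarrow> (nat list \<times> 'm) option" where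
  "braid_act V \<tau> [] ks = Some (ks, ident C (tensor_list V ks))"
| "braid_act V \<tau> (i # w) ks =
     (case braid_act V \<tau> w ks of
        None \<Rightarrow> None
      | Some (ls, f) \<Rightarrow>
          if ls ! (i - 1) \<le> ls ! i
          then Some (ls[i - 1 := ls ! i, i := ls ! (i - 1)], generator_arr V \<tau> i ls \<cdot> f)
          else None)"

text \<open>The braid \<open>w\<close> acting on the summand of index \<open>ks\<close>, followed by the inclusion of the target
  summand into \<open>T p \<otimes>\<^sub>o T q\<close>, where \<open>p + q\<close> is the length of \<open>ks\<close>.\<close>

definition braid_component ::
  "(nat \<Rightarrow> 'o) \<Rightarrow> (nat \<Rightarrow> nat \<Rightarrow> 'm) \<Rightarrow> (nat list \<Rightarrow> 'm) \<Rightarrow> nat \<Rightarrow> nat list \<Rightarrow> nat list \<Rightarrow> 'm" where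
  "braid_component V \<tau> incl p w ks =
     (case the (braid_act V \<tau> w ks) of
        (ls, f) \<Rightarrow> (incl (take p ls) \<otimes>\<^sub>a incl (drop p ls)) \<cdot> f)"

definition shuffle_coproduct ::
  "nat \<Rightarrow> (nat \<Rightarrow> 'o) \<Rightarrow> (nat \<Rightarrow> nat \<Rightarrow> 'm) \<Rightarrow>
   (nat \<Rightarrow> 'o) \<Rightarrow> (nat list \<Rightarrow> 'm) \<Rightarrow> (nat list \<Rightarrow> 'm) \<Rightarrow> nat \<Rightarrow> nat \<Rightarrow> 'm" where
  "shuffle_coproduct r V \<tau> T incl proj p q =
     arr_sum C (T (p + q)) (T p \<otimes>\<^sub>o T q)
       (\<lambda>\<theta>. arr_sum C (T (p + q)) (T p \<otimes>\<^sub>o T q)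
          (\<lambda>ks. braid_component V \<tau> incl p (braid_word (p + q) (inv_into UNIV \<theta>)) ks \<cdot> proj ks)
          (ordered_words r (p + q)))
       (Sh p q)"


section \<open>The differentials\<close>

definition right_differential ::
  "nat \<Rightarrow> (nat \<Rightarrow> 'o) \<Rightarrow> (nat \<Rightarrow> nat \<Rightarrow> 'm) \<Rightarrow> (nat \<Rightarrow> 'o) \<Rightarrow> (nat list \<Rightarrow> 'm) \<Rightarrow> (nat list \<Rightarrow> 'm) \<Rightarrow>
   'o \<Rightarrow> (nat \<Rightarrow> 'm) \<Rightarrow> 'o \<Rightarrow> nat \<Rightarrow> 'm" where
  "right_differential r V \<sigma> T incl proj M \<rho> N n =
     (right_action r T proj M \<rho> \<otimes>\<^sub>a ident C (T (n - 1) \<otimes>\<^sub>o N)) \<cdot>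
     (ident C M \<otimes>\<^sub>a shuffle_coproduct r V (neg_braiding V \<sigma>) T incl proj 1 (n - 1) \<otimes>\<^sub>a ident C N)"

definition left_differential ::
  "nat \<Rightarrow> (nat \<Rightarrow> 'o) \<Rightarrow> (nat \<Rightarrow> nat \<Rightarrow> 'm) \<Rightarrow> (nat \<Rightarrow> 'o) \<Rightarrow> (nat list \<Rightarrow> 'm) \<Rightarrow> (nat list \<Rightarrow> 'm) \<Rightarrow>
   'o \<Rightarrow> 'o \<Rightarrow> (nat \<Rightarrow> 'm) \<Rightarrow> nat \<Rightarrow> 'm" where
  "left_differential r V \<sigma> T incl proj M N lam n =
     arr_scale C (M \<otimes>\<^sub>o T n \<otimes>\<^sub>o N) (M \<otimes>\<^sub>o T (n - 1) \<otimes>\<^sub>o N) ((-1) ^ (n - 1))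
       ((ident C (M \<otimes>\<^sub>o T (n - 1)) \<otimes>\<^sub>a left_action r T proj N lam) \<cdot>
        (ident C M \<otimes>\<^sub>a shuffle_coproduct r V (neg_braiding V \<sigma>) T incl proj (n - 1) 1 \<otimes>\<^sub>a ident C N))"

definition bidifferential :: "(nat \<Rightarrow> 'o) \<Rightarrow> (nat \<Rightarrow> 'm) \<Rightarrow> (nat \<Rightarrow> 'm) \<Rightarrow> bool" where
  "bidifferential X d d' \<longleftrightarrow>
     (\<forall>n\<ge>1. d n \<in> Hom C (X n) (X (n - 1)) \<and> d' n \<in> Hom C (X n) (X (n - 1))) \<and>
     (\<forall>n>1. d (n - 1) \<cdot> d n = Zero C (X n) (X (n - 2)) \<and>
            d' (n - 1) \<cdot> d' n = Zero C (X n) (X (n - 2)) \<and>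
            Add C (d' (n - 1) \<cdot> d n) (d (n - 1) \<cdot> d' n) = Zero C (X n) (X (n - 2)))"

end

end

theory Submission
  imports Defs
begin

text \<open>The shuffles occurring in both differentials have a part with a single letter, so they are cycles, and
  their reduced words are unique (\<open>braid_word_up\<close>, \<open>braid_word_down\<close>). Put \<open>\<tau> = -\<sigma>\<close>. On the summand of
  a word \<open>k\<^sub>1 \<le> \<dots> \<le> k\<^sub>n\<close> the differential of \<open>M\<close> is therefore a sum over the positions of the word:
  the letter is moved to the left end by \<open>\<tau>\<close> and absorbed by \<open>M\<close>. The differential of \<open>N\<close> moves it to
  the right end and lets \<open>N\<close> absorb it, up to the sign \<open>(-1)\<^bsup>n-1\<^esup>\<close>. The composite of two
  differentials is a sum over ordered pairs of distinct positions, and it suffices to compare the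
  two orders in which a given pair of letters can be deleted.

  Two deletions to the left anticommute (\<open>act_right_act_right\<close>). If \<open>A\<close> is a word, then
  \<open>M \<otimes> V\<^sub>A\<close> is again a module for the letters that may follow \<open>A\<close>: it absorbs a letter by moving it through \<open>A\<close> and acting on \<open>M\<close>. The
  module relation for \<open>\<sigma>\<close>, which becomes an anticommutation for \<open>\<tau> = -\<sigma>\<close>, is inherited
  because of the Yang-Baxter equation, one letter of \<open>A\<close> at a time (\<open>act_right_anticommute\<close>); what lies
  between the two deleted letters is handled by the interchange law. The case of two deletions to
  the right is symmetric.

  A deletion to the left and one to the right commute. If the letter that goes to the left stands
  first, the two deletions take place in disjoint parts of the word. Otherwise the two letters cross
  each other and the word between them, and both orders of the crossings agree by the
  Yang-Baxter equation extended to words (\<open>yang_baxter_word\<close>, \<open>act_right_act_left\<close>). The signs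
  \<open>(-1)\<^bsup>n-1\<^esup>\<close> of consecutive degrees differ, which turns commutation into anticommutation.

  All arrows involved go between tensor products of words if \<open>M\<close> and \<open>N\<close> are regarded as two further
  letters, \<open>0\<close> and \<open>r + 1\<close>. Extending \<open>\<tau>\<close> and the actions by zero arrows to all indices, every
  expression below is a well-typed arrow, and the ordering of the letters is needed only
  for the relations between them.\<close>

section \<open>Reduced words of one-letter shuffles\<close>

lemma word_perm_Nil [simp]: "word_perm [] = id"
  and word_perm_Cons [simp]: "word_perm (i # w) = transpose i (Suc i) \<circ> word_perm w"
  by (simp_all add: word_perm_def)

lemma word_perm_append: "word_perm (u @ v) = word_perm u \<circ> word_perm v"
  by (induct u) (simp_all add: o_assoc)

lemma word_perm_rev: "word_perm (rev w) \<circ> word_perm w = id"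
proof (induct w)
  case (Cons i w)
  have "word_perm (rev (i # w)) \<circ> word_perm (i # w)
    = word_perm (rev w) \<circ> (transpose i (Suc i) \<circ> transpose i (Suc i)) \<circ> word_perm w"
    by (simp only: word_perm_append word_perm_Cons word_perm_Nil rev.simps comp_assoc comp_id)
  then show ?case by (simp only: Cons transpose_comp_involutory comp_id)
qed simp

lemma inv_word_perm: "inv_into UNIV (word_perm w) = word_perm (rev w)"
  using word_perm_rev[of w] word_perm_rev[of "rev w"] by (intro inv_unique_comp) simp_all

lemma word_perm_permutes:
  "set w \<subseteq> {1..<n} \<Longrightarrow> word_perm w permutes {1..n}"
proof (induct w)
  case Nil show ?case unfolding word_perm_Nil by (rule permutes_id)
next
  case (Cons i w)
  then have "transpose i (Suc i) permutes {1..n}" by (intro permutes_swap_id) auto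
  moreover have "word_perm w permutes {1..n}" using Cons by simp
  ultimately show ?case unfolding word_perm_Cons by (rule permutes_compose[rotated])
qed

lemma word_perm_up: "j \<le> k \<Longrightarrow> word_perm [j..<k] x =
    (if x = k then j else if j \<le> x \<and> x < k then Suc x else x)"
proof (induct "k - j" arbitrary: j)
  case (Suc m)
  then have "[j..<k] = j # [Suc j..<k]" by (simp add: upt_rec)
  with Suc(1)[of "Suc j"] Suc(2,3) show ?case by (auto simp: transpose_def)
qed auto

lemma word_perm_down: "j \<le> k \<Longrightarrow> word_perm (rev [j..<k]) x =
    (if x = j then k else if j < x \<and> x \<le> k then x - 1 else x)"
proof (induct "k - j" arbitrary: k)
  case (Suc m)
  then obtain k' where k: "k = Suc k'" "j \<le> k'" by (cases k) auto
  with Suc(1)[of k'] Suc(2,3) show ?case by (auto simp: transpose_def)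
qed auto

text \<open>A generator shifts a position by at most one. Hence a word that takes \<open>k\<close> down to \<open>j\<close> has at least
  \<open>k - j\<close> letters, and if it has no more than that, each of them moves the position one step down and is
  determined by it.\<close>

lemma word_moving_down:
  assumes "word_perm w k = j" "j \<le> k"
  shows "k \<le> j + length w \<and> (k = j + length w \<longrightarrow> w = [j..<k])"
  using assms
proof (induct w arbitrary: j)
  case (Cons i w)
  define m where "m = word_perm w k"
  have j: "j = transpose i (Suc i) m" using Cons(2) by (simp add: m_def)
  show ?case
  proof (cases "m \<le> k")
    case True
    with Cons(1)[of m] have IH: "k \<le> m + length w" "k = m + length w \<longrightarrow> w = [m..<k]"
      by (auto simp: m_def)
    have "m \<le> j \<or> m = Suc j \<and> i = j"
      unfolding j by (cases "m = i"; cases "m = Suc i") simp_all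
    then have mj: "m \<le> Suc j" "m = Suc j \<Longrightarrow> i = j" by linarith+
    show ?thesis
    proof (intro conjI impI)
      show "k \<le> j + length (i # w)" using IH(1) mj(1) by simp
      assume "k = j + length (i # w)"
      then have "m = Suc j" "k = m + length w" using IH(1) mj(1) unfolding length_Cons by linarith+
      then show "i # w = [j..<k]" using IH(2) mj(2) by (simp add: upt_conv_Cons del: upt_Suc)
    qed
  next
    case False
    then have "j = k" using Cons(3) unfolding j transpose_def by (simp split: if_splits)
    then show ?thesis by simp
  qed
qed simp

lemma word_moving_up:
  assumes "word_perm w j = k" "j \<le> k"
  shows "k \<le> j + length w \<and> (k = j + length w \<longrightarrow> w = rev [j..<k])"
  using assms
proof (induct w arbitrary: k)
  case (Cons i w)
  define m where "m = word_perm w j"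
  have k: "k = transpose i (Suc i) m" using Cons(2) by (simp add: m_def)
  show ?case
  proof (cases "j \<le> m")
    case True
    with Cons(1)[of m] have IH: "m \<le> j + length w" "m = j + length w \<longrightarrow> w = rev [j..<m]"
      by (auto simp: m_def)
    have "k \<le> m \<or> k = Suc m \<and> i = m"
      unfolding k by (cases "m = i"; cases "m = Suc i") simp_all
    then have mj: "k \<le> Suc m" "k = Suc m \<Longrightarrow> i = m" by linarith+
    show ?thesis
    proof (intro conjI impI)
      show "k \<le> j + length (i # w)" using IH(1) mj(1) by simp
      assume "k = j + length (i # w)"
      then have "k = Suc m" "m = j + length w" using IH(1) mj(1) unfolding length_Cons by linarith+
      then show "i # w = rev [j..<k]" using IH(2) mj(2) True by simp
    qed
  next
    case False
    then have "k = j" using Cons(3) unfolding k transpose_def by (simp split: if_splits)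
    then show ?thesis by simp
  qed
qed simp

lemma braid_word_unique:
  assumes "set w \<subseteq> {1..<n}"
    and "\<And>v. word_perm v = word_perm w \<Longrightarrow> length v \<le> length w \<Longrightarrow> v = w"
  shows "braid_word n (word_perm w) = w"
proof -
  let ?P = "\<lambda>v. set v \<subseteq> {1..<n} \<and> word_perm v = word_perm w"
  have "?P (arg_min length ?P)" "length (arg_min length ?P) \<le> length w"
    using arg_min_nat_lemma[of ?P w length] assms(1) by blast+
  then show ?thesis using assms(2) by (simp add: braid_word_def)
qed

lemma braid_word_up:
  assumes "1 \<le> j" "j \<le> k" "k \<le> n"
  shows "braid_word n (word_perm [j..<k]) = [j..<k]"
proof (rule braid_word_unique)
  show "set [j..<k] \<subseteq> {1..<n}" using assms by auto
next
  fix v assume "word_perm v = word_perm [j..<k]" and v: "length v \<le> length [j..<k]"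
  then have "k \<le> j + length v" and *: "k = j + length v \<longrightarrow> v = [j..<k]"
    using word_moving_down[of v k j] word_perm_up[of j k k] assms(2) by simp_all
  then have "k = j + length v" using v assms(2) by simp
  with * show "v = [j..<k]" by (rule mp)
qed

lemma braid_word_down:
  assumes "1 \<le> j" "j \<le> k" "k \<le> n"
  shows "braid_word n (word_perm (rev [j..<k])) = rev [j..<k]"
proof (rule braid_word_unique)
  show "set (rev [j..<k]) \<subseteq> {1..<n}" using assms by auto
next
  fix v assume "word_perm v = word_perm (rev [j..<k])" and v: "length v \<le> length (rev [j..<k])"
  then have "k \<le> j + length v" and *: "k = j + length v \<longrightarrow> v = rev [j..<k]"
    using word_moving_up[of v j k] word_perm_down[of j k j] assms(2) by simp_all
  then have "k = j + length v" using v assms(2) by simp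
  with * show "v = rev [j..<k]" by (rule mp)
qed

lemma strict_mono_on_eqI:
  fixes f g :: "nat \<Rightarrow> nat"
  assumes "strict_mono_on {a..b} f" "strict_mono_on {a..b} g" "f ` {a..b} = g ` {a..b}" "x \<in> {a..b}"
  shows "f x = g x"
proof -
  have *: "sorted_wrt (<) (map h [a..<Suc b])" if "strict_mono_on {a..b} h" for h :: "nat \<Rightarrow> nat"
    unfolding sorted_wrt_map
    by (rule sorted_wrt_mono_rel[OF _ sorted_wrt_upt])
      (use that in \<open>simp add: strict_mono_onD less_Suc_eq_le del: upt_Suc\<close>)
  have set: "set [a..<Suc b] = {a..b}" by auto
  have "map f [a..<Suc b] = map g [a..<Suc b]"
    by (rule strict_sorted_equal[OF *[OF assms(2)] *[OF assms(1)]]) (simp only: set_map set assms(3))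
  then have "\<forall>x\<in>{a..b}. f x = g x" unfolding map_eq_conv set .
  then show ?thesis using assms(4) by (rule bspec)
qed

text \<open>A shuffle is increasing on the longer part, so the image of the single letter of the other part
  determines it.\<close>

lemma shuffles_one_left:
  "bij_betw (\<lambda>k. word_perm (rev [1..<Suc k])) {..<Suc q} (Sh 1 q)"
proof (rule bij_betwI')
  fix k l assume "k \<in> {..<Suc q}" "l \<in> {..<Suc q}"
  show "word_perm (rev [1..<Suc k]) = word_perm (rev [1..<Suc l]) \<longleftrightarrow> k = l"
  proof
    assume "word_perm (rev [1..<Suc k]) = word_perm (rev [1..<Suc l])"
    then have "word_perm (rev [1..<Suc k]) 1 = word_perm (rev [1..<Suc l]) 1" by (rule fun_cong)
    then show "k = l" by (simp add: word_perm_down del: upt_Suc)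
  qed simp
next
  fix k assume k: "k \<in> {..<Suc q}"
  have "word_perm (rev [1..<Suc k]) permutes {1..1 + q}"
    using k by (intro word_perm_permutes) auto
  then show "word_perm (rev [1..<Suc k]) \<in> Sh 1 q"
    unfolding Sh_def mem_Collect_eq
    by (intro conjI strict_mono_onI) (auto simp: word_perm_down simp del: upt_Suc)
next
  fix \<theta> assume \<theta>: "\<theta> \<in> Sh 1 q"
  then have p: "\<theta> permutes {1..1 + q}" and m: "strict_mono_on {1+1..1+q} \<theta>" by (auto simp: Sh_def)
  have "\<theta> 1 \<in> {1..1+q}" using permutes_in_image[OF p, of 1] by auto
  then obtain k where k: "\<theta> 1 = Suc k" "k < Suc q" by (cases "\<theta> 1") auto
  define \<eta> where "\<eta> = word_perm (rev [1..<Suc k])"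
  have p': "\<eta> permutes {1..1 + q}" unfolding \<eta>_def using k by (intro word_perm_permutes) auto
  have \<eta>1: "\<eta> 1 = Suc k" by (simp add: \<eta>_def word_perm_down del: upt_Suc)
  have img: "h ` {1+1..1+q} = {1..1+q} - {Suc k}" if h: "h permutes {1..1 + q}" "h 1 = Suc k" for h
  proof -
    have "{1+1..1+q} = {1..1+q} - {1}" by auto
    then have "h ` {1+1..1+q} = h ` {1..1+q} - h ` {1}"
      using permutes_inj[OF h(1)] by (simp only: image_set_diff)
    then show ?thesis using permutes_image[OF h(1)] h(2) by simp
  qed
  have m': "strict_mono_on {1+1..1+q} \<eta>"
    by (rule strict_mono_onI) (auto simp: \<eta>_def word_perm_down simp del: upt_Suc)
  have "\<theta> x = \<eta> x" for x
  proof -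
    consider "x = 1" | "x \<in> {1+1..1+q}" | "x \<notin> {1..1+q}" by force
    then show ?thesis
    proof cases
      case 2
      then show ?thesis
        using strict_mono_on_eqI[OF m m'] img[OF p k(1)] img[OF p' \<eta>1] by simp
    next
      case 3
      show ?thesis by (simp only: permutes_not_in[OF p 3] permutes_not_in[OF p' 3])
    qed (simp only: k(1) \<eta>1)
  qed
  then have "\<theta> = \<eta>" by (rule ext)
  then show "\<exists>k\<in>{..<Suc q}. \<theta> = word_perm (rev [1..<Suc k])" unfolding \<eta>_def
    using k(2) by (intro bexI[of _ k] lessThan_iff[THEN iffD2])
qed

lemma shuffles_one_right:
  "bij_betw (\<lambda>k. word_perm [Suc k..<Suc q]) {..<Suc q} (Sh q 1)"
proof (rule bij_betwI')
  fix k l assume kl: "k \<in> {..<Suc q}" "l \<in> {..<Suc q}"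
  show "word_perm [Suc k..<Suc q] = word_perm [Suc l..<Suc q] \<longleftrightarrow> k = l"
  proof
    assume "word_perm [Suc k..<Suc q] = word_perm [Suc l..<Suc q]"
    then have "word_perm [Suc k..<Suc q] (Suc q) = word_perm [Suc l..<Suc q] (Suc q)"
      by (rule fun_cong)
    then show "k = l" using kl by (simp add: word_perm_up del: upt_Suc)
  qed simp
next
  fix k assume k: "k \<in> {..<Suc q}"
  have "word_perm [Suc k..<Suc q] permutes {1..q + 1}"
    using k by (intro word_perm_permutes) auto
  then show "word_perm [Suc k..<Suc q] \<in> Sh q 1"
    unfolding Sh_def mem_Collect_eq using k
    by (intro conjI strict_mono_onI) (auto simp: word_perm_up simp del: upt_Suc)
next
  fix \<theta> assume \<theta>: "\<theta> \<in> Sh q 1"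
  then have p: "\<theta> permutes {1..Suc q}" and m: "strict_mono_on {1..q} \<theta>" by (auto simp: Sh_def)
  have "\<theta> (Suc q) \<in> {1..Suc q}" using permutes_in_image[OF p, of "Suc q"] by auto
  then obtain k where k: "\<theta> (Suc q) = Suc k" "k < Suc q" by (cases "\<theta> (Suc q)") auto
  define \<eta> where "\<eta> = word_perm [Suc k..<Suc q]"
  have p': "\<eta> permutes {1..Suc q}" unfolding \<eta>_def using k by (intro word_perm_permutes) auto
  have \<eta>1: "\<eta> (Suc q) = Suc k" using k by (simp add: \<eta>_def word_perm_up del: upt_Suc)
  have img: "h ` {1..q} = {1..Suc q} - {Suc k}" if h: "h permutes {1..Suc q}" "h (Suc q) = Suc k" for h
  proof -
    have "{1..q} = {1..Suc q} - {Suc q}" by auto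
    then have "h ` {1..q} = h ` {1..Suc q} - h ` {Suc q}"
      using permutes_inj[OF h(1)] by (simp only: image_set_diff)
    then show ?thesis using permutes_image[OF h(1)] h(2) by simp
  qed
  have m': "strict_mono_on {1..q} \<eta>"
    using k by (intro strict_mono_onI) (auto simp: \<eta>_def word_perm_up simp del: upt_Suc)
  have "\<theta> x = \<eta> x" for x
  proof -
    consider "x = Suc q" | "x \<in> {1..q}" | "x \<notin> {1..Suc q}" by force
    then show ?thesis
    proof cases
      case 2
      then show ?thesis
        using strict_mono_on_eqI[OF m m'] img[OF p k(1)] img[OF p' \<eta>1] by simp
    next
      case 3
      show ?thesis by (simp only: permutes_not_in[OF p 3] permutes_not_in[OF p' 3])
    qed (simp only: k(1) \<eta>1)
  qed
  then have "\<theta> = \<eta>" by (rule ext)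
  then show "\<exists>k\<in>{..<Suc q}. \<theta> = word_perm [Suc k..<Suc q]" unfolding \<eta>_def
    using k(2) by (intro bexI[of _ k] lessThan_iff[THEN iffD2])
qed

section \<open>Arrows of an additive monoidal category\<close>

lemma (in comm_group) finprod_hom:
  assumes H: "comm_group H" and h: "h \<in> hom G H" and f: "f \<in> I \<rightarrow> carrier G"
  shows "h (finprod G f I) = finprod H (\<lambda>i. h (f i)) I"
proof -
  interpret H: comm_group H by fact
  interpret h: group_hom G H h
    by (simp add: group_hom_def group_hom_axioms_def h is_group H.is_group)
  show ?thesis using f
  proof (induct I rule: infinite_finite_induct)
    case (insert i I)
    then show ?case by (simp add: Pi_def h.hom_mult)
  qed simp_all
qed

text \<open>Composites of two deletions are indexed by pairs of positions, the second one counted in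
  the shortened word. Deleting position \<open>k\<close> and then \<open>l \<ge> k\<close> removes the same two letters as
  deleting \<open>l + 1\<close> and then \<open>k\<close>; the double sum is regrouped accordingly.\<close>

lemma (in comm_group) finprod_pair_deletions:
  assumes f: "\<And>k l. k \<le> n \<Longrightarrow> l < n \<Longrightarrow> f k l \<in> carrier G"
  shows "(\<Otimes>k\<in>{..<Suc n}. \<Otimes>l\<in>{..<n}. f k l) =
         (\<Otimes>l\<in>{..<n}. \<Otimes>k\<in>{..l}. f k l \<otimes> f (Suc l) k)"
  using f
proof (induct n)
  case (Suc n)
  have IH: "(\<Otimes>k\<in>{..<Suc n}. \<Otimes>l\<in>{..<n}. f k l) =
         (\<Otimes>l\<in>{..<n}. \<Otimes>k\<in>{..l}. f k l \<otimes> f (Suc l) k)"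
    by (rule Suc(1)) (simp add: Suc(2))
  have *: "(\<Otimes>l\<in>{..<Suc n}. f k l) = (\<Otimes>l\<in>{..<n}. f k l) \<otimes> f k n" if "k \<le> Suc n" for k
    using that Suc(2) by (subst lessThan_Suc) (simp add: Pi_def m_comm)
  define g where "g = (\<lambda>l. \<Otimes>k\<in>{..l}. f k l \<otimes> f (Suc l) k)"
  have "(\<Otimes>k\<in>{..<Suc (Suc n)}. \<Otimes>l\<in>{..<Suc n}. f k l) =
      (\<Otimes>l\<in>{..<Suc n}. f (Suc n) l) \<otimes> (\<Otimes>k\<in>{..<Suc n}. \<Otimes>l\<in>{..<Suc n}. f k l)"
    using Suc(2) by (subst lessThan_Suc) (simp add: Pi_def)
  also have "(\<Otimes>k\<in>{..<Suc n}. \<Otimes>l\<in>{..<Suc n}. f k l) =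
      (\<Otimes>k\<in>{..<Suc n}. (\<Otimes>l\<in>{..<n}. f k l) \<otimes> f k n)"
    using Suc(2) by (intro finprod_cong') (auto simp: Pi_def *)
  also have "\<dots> = (\<Otimes>k\<in>{..<Suc n}. \<Otimes>l\<in>{..<n}. f k l) \<otimes> (\<Otimes>k\<in>{..<Suc n}. f k n)"
    using Suc(2) by (intro finprod_multf) (auto simp: Pi_def)
  also have "(\<Otimes>l\<in>{..<Suc n}. f (Suc n) l) \<otimes> \<dots> =
      (\<Otimes>k\<in>{..<Suc n}. f k n \<otimes> f (Suc n) k) \<otimes> (\<Otimes>k\<in>{..<Suc n}. \<Otimes>l\<in>{..<n}. f k l)"
    using Suc(2) by (subst finprod_multf) (auto simp: Pi_def m_ac)
  also have "\<dots> = g n \<otimes> finprod G g {..<n}"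
    using IH by (simp add: g_def lessThan_Suc_atMost)
  also have "\<dots> = finprod G g {..<Suc n}"
    using Suc(2) by (simp add: lessThan_Suc g_def Pi_def)
  finally show ?case by (simp add: g_def)
qed simp

context strict_monoidal_category
begin

lemma ident_arr [simp]: "X \<in> Obj C \<Longrightarrow> ident C X \<in> Arr C"
  and dom_ident [simp]: "X \<in> Obj C \<Longrightarrow> Dom C (ident C X) = X"
  and cod_ident [simp]: "X \<in> Obj C \<Longrightarrow> Cod C (ident C X) = X"
  using ident_hom by (auto simp: Hom_def)

lemma comp_arr [simp]: "\<lbrakk>f \<in> Arr C; g \<in> Arr C; Cod C f = Dom C g\<rbrakk> \<Longrightarrow> g \<cdot> f \<in> Arr C"
  and dom_comp [simp]: "\<lbrakk>f \<in> Arr C; g \<in> Arr C; Cod C f = Dom C g\<rbrakk> \<Longrightarrow> Dom C (g \<cdot> f) = Dom C f"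
  and cod_comp [simp]: "\<lbrakk>f \<in> Arr C; g \<in> Arr C; Cod C f = Dom C g\<rbrakk> \<Longrightarrow> Cod C (g \<cdot> f) = Cod C g"
  using comp_hom[of f "Dom C f" "Cod C f" g "Cod C g"] by (auto simp: Hom_def)

lemma tarr_arr [simp]: "\<lbrakk>f \<in> Arr C; g \<in> Arr C\<rbrakk> \<Longrightarrow> f \<otimes>\<^sub>a g \<in> Arr C"
  and dom_tarr [simp]: "\<lbrakk>f \<in> Arr C; g \<in> Arr C\<rbrakk> \<Longrightarrow> Dom C (f \<otimes>\<^sub>a g) = Dom C f \<otimes>\<^sub>o Dom C g"
  and cod_tarr [simp]: "\<lbrakk>f \<in> Arr C; g \<in> Arr C\<rbrakk> \<Longrightarrow> Cod C (f \<otimes>\<^sub>a g) = Cod C f \<otimes>\<^sub>o Cod C g"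
  using tarr_hom[of f "Dom C f" "Cod C f" g "Dom C g" "Cod C g"] by (auto simp: Hom_def)

lemma assoc [simp]:
  "\<lbrakk>f \<in> Arr C; g \<in> Arr C; h \<in> Arr C; Cod C f = Dom C g; Cod C g = Dom C h\<rbrakk>
    \<Longrightarrow> (h \<cdot> g) \<cdot> f = h \<cdot> (g \<cdot> f)"
  by (rule comp_assoc[of f "Dom C f" "Cod C f" g "Cod C g" h "Cod C h"]) (auto simp: Hom_def)

lemma ident_comp [simp]: "\<lbrakk>f \<in> Arr C; Cod C f = X\<rbrakk> \<Longrightarrow> ident C X \<cdot> f = f"
  and comp_ident [simp]: "\<lbrakk>f \<in> Arr C; Dom C f = X\<rbrakk> \<Longrightarrow> f \<cdot> ident C X = f"
  using comp_ident_left[of f "Dom C f" X] comp_ident_right[of f X "Cod C f"] by (auto simp: Hom_def)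

lemma tarr_interchange:
  "\<lbrakk>f \<in> Arr C; g \<in> Arr C; f' \<in> Arr C; g' \<in> Arr C; Cod C f = Dom C g; Cod C f' = Dom C g'\<rbrakk>
    \<Longrightarrow> (g \<otimes>\<^sub>a g') \<cdot> (f \<otimes>\<^sub>a f') = (g \<cdot> f) \<otimes>\<^sub>a (g' \<cdot> f')"
  by (rule tarr_comp[symmetric]) (auto simp: Hom_def)

declare unit_obj [simp] tobj_obj [simp] tobj_assoc [simp] tobj_unit_left [simp]
  tobj_unit_right [simp] tarr_ident [simp] tarr_assoc [simp] tarr_unit_left [simp]
  tarr_unit_right [simp] dom_obj [simp] cod_obj [simp]

end

context additive_monoidal_category
begin

lemma carrier_hom_group [simp]: "carrier (hom_group C X Y) = Hom C X Y"
  and mult_hom_group [simp]: "monoid.mult (hom_group C X Y) = Add C"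
  and one_hom_group [simp]: "one (hom_group C X Y) = Zero C X Y"
  by (simp_all add: hom_group_def)

lemma postcomp_hom:
  assumes "g \<in> Arr C" "Dom C g = Y"
  shows "(\<lambda>f. g \<cdot> f) \<in> hom (hom_group C X Y) (hom_group C X (Cod C g))"
  using assms by (auto simp: hom_def comp_add_right[where Z = "Cod C g"] Hom_def)

lemma precomp_hom:
  assumes "f \<in> Arr C" "Cod C f = Y"
  shows "(\<lambda>g. g \<cdot> f) \<in> hom (hom_group C Y Z) (hom_group C (Dom C f) Z)"
  using assms by (auto simp: hom_def comp_add_left[where X = "Dom C f"] Hom_def)

lemma tensor_left_hom:
  assumes "g \<in> Arr C"
  shows "(\<lambda>f. g \<otimes>\<^sub>a f) \<in> hom (hom_group C X Y) (hom_group C (Dom C g \<otimes>\<^sub>o X) (Cod C g \<otimes>\<^sub>o Y))"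
  using assms by (auto simp: hom_def tarr_add_right Hom_def)

lemma tensor_right_hom:
  assumes "g \<in> Arr C"
  shows "(\<lambda>f. f \<otimes>\<^sub>a g) \<in> hom (hom_group C X Y) (hom_group C (X \<otimes>\<^sub>o Dom C g) (Y \<otimes>\<^sub>o Cod C g))"
  using assms by (auto simp: hom_def tarr_add_left Hom_def)

lemma Hom_obj: "f \<in> Hom C X Y \<Longrightarrow> X \<in> Obj C \<and> Y \<in> Obj C"
  by (auto simp: Hom_def)

lemma zero_arr [simp]: "\<lbrakk>X \<in> Obj C; Y \<in> Obj C\<rbrakk> \<Longrightarrow> Zero C X Y \<in> Arr C"
  and dom_zero [simp]: "\<lbrakk>X \<in> Obj C; Y \<in> Obj C\<rbrakk> \<Longrightarrow> Dom C (Zero C X Y) = X"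
  and cod_zero [simp]: "\<lbrakk>X \<in> Obj C; Y \<in> Obj C\<rbrakk> \<Longrightarrow> Cod C (Zero C X Y) = Y"
  using monoid.one_closed[OF comm_monoid.axioms(1)[OF comm_group.axioms(1)[OF hom_comm_group]], of X Y]
  by (auto simp: Hom_def)

text \<open>The negative as an operation on arrows alone, with their hom-set read off, so that it can be moved
  through composites and tensor products by rewriting.\<close>

definition neg :: "'b \<Rightarrow> 'b"
  where "neg f = arr_neg C (Dom C f) (Cod C f) f"

lemma neg_hom: "f \<in> Arr C \<Longrightarrow> neg f \<in> Hom C (Dom C f) (Cod C f)"
proof -
  assume f: "f \<in> Arr C"
  then interpret G: comm_group "hom_group C (Dom C f) (Cod C f)" by (simp add: hom_comm_group)
  show ?thesis using f G.inv_closed[of f] by (simp add: neg_def arr_neg_def Hom_def)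
qed

lemma neg_arr [simp]: "f \<in> Arr C \<Longrightarrow> neg f \<in> Arr C"
  and dom_neg [simp]: "f \<in> Arr C \<Longrightarrow> Dom C (neg f) = Dom C f"
  and cod_neg [simp]: "f \<in> Arr C \<Longrightarrow> Cod C (neg f) = Cod C f"
  using neg_hom[of f] by (auto simp: Hom_def)

lemma hom_neg:
  assumes h: "h \<in> hom (hom_group C (Dom C f) (Cod C f)) (hom_group C X Y)"
    and f: "f \<in> Arr C" and XY: "X \<in> Obj C" "Y \<in> Obj C"
  shows "h (neg f) = neg (h f)"
proof -
  interpret h: group_hom "hom_group C (Dom C f) (Cod C f)" "hom_group C X Y" h
    unfolding group_hom_def group_hom_axioms_def
    using assms hom_comm_group by (simp add: comm_group.axioms)
  have "h f \<in> Hom C X Y" using h f by (auto simp: hom_def Hom_def Pi_def)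
  then show ?thesis using h.hom_inv[of f] f
    by (simp add: neg_def arr_neg_def Hom_def)
qed

lemma neg_comp [simp]: "\<lbrakk>f \<in> Arr C; g \<in> Arr C; Cod C f = Dom C g\<rbrakk> \<Longrightarrow> neg g \<cdot> f = neg (g \<cdot> f)"
  and comp_neg [simp]: "\<lbrakk>f \<in> Arr C; g \<in> Arr C; Cod C f = Dom C g\<rbrakk> \<Longrightarrow> g \<cdot> neg f = neg (g \<cdot> f)"
  and tarr_neg [simp]: "\<lbrakk>f \<in> Arr C; g \<in> Arr C\<rbrakk> \<Longrightarrow> g \<otimes>\<^sub>a neg f = neg (g \<otimes>\<^sub>a f)"
  and neg_tarr [simp]: "\<lbrakk>f \<in> Arr C; g \<in> Arr C\<rbrakk> \<Longrightarrow> neg g \<otimes>\<^sub>a f = neg (g \<otimes>\<^sub>a f)"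
     apply (subst hom_neg[OF precomp_hom[of f]]; simp)
    apply (subst hom_neg[OF postcomp_hom[of g]]; simp)
   apply (subst hom_neg[OF tensor_left_hom[of g]]; simp)
  apply (subst hom_neg[OF tensor_right_hom[of f]]; simp)
  done

lemma neg_neg [simp]: "f \<in> Arr C \<Longrightarrow> neg (neg f) = f"
proof -
  assume f: "f \<in> Arr C"
  then interpret G: comm_group "hom_group C (Dom C f) (Cod C f)" by (simp add: hom_comm_group)
  show ?thesis using f neg_arr[OF f] G.inv_inv[of f]
    by (simp add: neg_def[of "neg f"]) (simp add: neg_def arr_neg_def Hom_def)
qed

lemma add_neg [simp]: "f \<in> Arr C \<Longrightarrow> Add C f (neg f) = Zero C (Dom C f) (Cod C f)"
  and neg_add [simp]: "f \<in> Arr C \<Longrightarrow> Add C (neg f) f = Zero C (Dom C f) (Cod C f)"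
proof -
  assume f: "f \<in> Arr C"
  then interpret G: comm_group "hom_group C (Dom C f) (Cod C f)" by (simp add: hom_comm_group)
  show "Add C f (neg f) = Zero C (Dom C f) (Cod C f)" "Add C (neg f) f = Zero C (Dom C f) (Cod C f)"
    using f G.r_inv[of f] G.l_inv[of f] by (simp_all add: neg_def arr_neg_def Hom_def)
qed

lemma arr_sum_hom:
  assumes "X \<in> Obj C" "Y \<in> Obj C" "\<And>i. i \<in> I \<Longrightarrow> f i \<in> Hom C X Y"
  shows "arr_sum C X Y f I \<in> Hom C X Y"
proof -
  interpret G: comm_group "hom_group C X Y" using assms by (simp add: hom_comm_group)
  show ?thesis using G.finprod_closed[of f I] assms by (auto simp: arr_sum_def)
qed

lemma arr_sum_cong:
  assumes "X \<in> Obj C" "Y \<in> Obj C" "I = J" "\<And>i. i \<in> J \<Longrightarrow> g i \<in> Hom C X Y" "\<And>i. i \<in> J \<Longrightarrow> f i = g i"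
  shows "arr_sum C X Y f I = arr_sum C X Y g J"
proof -
  interpret G: comm_group "hom_group C X Y" using assms by (simp add: hom_comm_group)
  show ?thesis unfolding arr_sum_def by (rule G.finprod_cong') (use assms in auto)
qed

lemma arr_sum_delta:
  assumes "finite I" "j \<in> I" "f j \<in> Hom C X Y" "\<And>i. i \<in> I \<Longrightarrow> i \<noteq> j \<Longrightarrow> f i = Zero C X Y"
  shows "arr_sum C X Y f I = f j"
proof -
  interpret G: comm_group "hom_group C X Y" using assms(3) Hom_obj by (simp add: hom_comm_group)
  have f: "f \<in> I \<rightarrow> Hom C X Y"
    using assms Hom_obj[OF assms(3)] by (force simp: Hom_def)
  have "finprod (hom_group C X Y) f I
      = finprod (hom_group C X Y) (\<lambda>i. if j = i then f i else Zero C X Y) I"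
    using assms Hom_obj[OF assms(3)] by (intro G.finprod_cong') (auto simp: Hom_def)
  also have "\<dots> = f j" using G.finprod_singleton[of j I f, unfolded one_hom_group] f assms by simp
  finally show ?thesis by (simp add: arr_sum_def)
qed

lemma hom_arr_sum:
  assumes h: "h \<in> hom (hom_group C X Y) (hom_group C X' Y')"
    and obj: "X \<in> Obj C" "Y \<in> Obj C" "X' \<in> Obj C" "Y' \<in> Obj C"
    and f: "\<And>i. i \<in> I \<Longrightarrow> f i \<in> Hom C X Y"
  shows "h (arr_sum C X Y f I) = arr_sum C X' Y' (\<lambda>i. h (f i)) I"
  unfolding arr_sum_def
  using comm_group.finprod_hom[OF hom_comm_group hom_comm_group h, of f I] obj f by auto

lemma comp_arr_sum:
  assumes "g \<in> Arr C" "Dom C g = Y" "X \<in> Obj C" "\<And>i. i \<in> I \<Longrightarrow> f i \<in> Hom C X Y"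
  shows "g \<cdot> arr_sum C X Y f I = arr_sum C X (Cod C g) (\<lambda>i. g \<cdot> f i) I"
  using assms by (intro hom_arr_sum[OF postcomp_hom]) auto

lemma arr_sum_comp:
  assumes "f \<in> Arr C" "Cod C f = Y" "Z \<in> Obj C" "\<And>i. i \<in> I \<Longrightarrow> g i \<in> Hom C Y Z"
  shows "arr_sum C Y Z g I \<cdot> f = arr_sum C (Dom C f) Z (\<lambda>i. g i \<cdot> f) I"
  using assms by (intro hom_arr_sum[OF precomp_hom]) auto

lemma tarr_arr_sum:
  assumes "g \<in> Arr C" "X \<in> Obj C" "Y \<in> Obj C" "\<And>i. i \<in> I \<Longrightarrow> f i \<in> Hom C X Y"
  shows "g \<otimes>\<^sub>a arr_sum C X Y f I
    = arr_sum C (Dom C g \<otimes>\<^sub>o X) (Cod C g \<otimes>\<^sub>o Y) (\<lambda>i. g \<otimes>\<^sub>a f i) I"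
  using assms by (intro hom_arr_sum[OF tensor_left_hom]) auto

lemma arr_sum_tarr:
  assumes "g \<in> Arr C" "X \<in> Obj C" "Y \<in> Obj C" "\<And>i. i \<in> I \<Longrightarrow> f i \<in> Hom C X Y"
  shows "arr_sum C X Y f I \<otimes>\<^sub>a g
    = arr_sum C (X \<otimes>\<^sub>o Dom C g) (Y \<otimes>\<^sub>o Cod C g) (\<lambda>i. f i \<otimes>\<^sub>a g) I"
  using assms by (intro hom_arr_sum[OF tensor_right_hom]) auto

lemma arr_sum_pair_deletions:
  assumes "X \<in> Obj C" "Y \<in> Obj C" "\<And>k l. k \<le> n \<Longrightarrow> l < n \<Longrightarrow> f k l \<in> Hom C X Y"
  shows "arr_sum C X Y (\<lambda>k. arr_sum C X Y (f k) {..<n}) {..<Suc n}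
    = arr_sum C X Y (\<lambda>l. arr_sum C X Y (\<lambda>k. Add C (f k l) (f (Suc l) k)) {..l}) {..<n}"
  using comm_group.finprod_pair_deletions[OF hom_comm_group, of X Y n f] assms
  by (simp add: arr_sum_def)

lemma scale_sign:
  assumes "f \<in> Arr C"
  shows "arr_scale C (Dom C f) (Cod C f) ((-1) ^ n) f = (if even n then f else neg f)"
proof -
  interpret G: comm_group "hom_group C (Dom C f) (Cod C f)" using assms by (simp add: hom_comm_group)
  show ?thesis using assms G.int_pow_neg[of f 1] G.int_pow_1[of f]
    by (simp add: arr_scale_def Hom_def neg_def arr_neg_def)
qed

lemma hom_zero:
  assumes h: "h \<in> hom (hom_group C X Y) (hom_group C X' Y')"
    and obj: "X \<in> Obj C" "Y \<in> Obj C" "X' \<in> Obj C" "Y' \<in> Obj C"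
  shows "h (Zero C X Y) = Zero C X' Y'"
proof -
  interpret h: group_hom "hom_group C X Y" "hom_group C X' Y'" h
    unfolding group_hom_def group_hom_axioms_def
    using assms hom_comm_group by (simp add: comm_group.axioms)
  show ?thesis using h.hom_one by simp
qed

lemma comp_zero [simp]:
    "\<lbrakk>g \<in> Arr C; Dom C g = Y; X \<in> Obj C\<rbrakk> \<Longrightarrow> g \<cdot> Zero C X Y = Zero C X (Cod C g)"
  and zero_comp [simp]:
    "\<lbrakk>f \<in> Arr C; Cod C f = Y; Z \<in> Obj C\<rbrakk> \<Longrightarrow> Zero C Y Z \<cdot> f = Zero C (Dom C f) Z"
  and tarr_zero [simp]: "\<lbrakk>g \<in> Arr C; X \<in> Obj C; Y \<in> Obj C\<rbrakk>
     \<Longrightarrow> g \<otimes>\<^sub>a Zero C X Y = Zero C (Dom C g \<otimes>\<^sub>o X) (Cod C g \<otimes>\<^sub>o Y)"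
  and zero_tarr [simp]: "\<lbrakk>g \<in> Arr C; X \<in> Obj C; Y \<in> Obj C\<rbrakk>
     \<Longrightarrow> Zero C X Y \<otimes>\<^sub>a g = Zero C (X \<otimes>\<^sub>o Dom C g) (Y \<otimes>\<^sub>o Cod C g)"
  using hom_zero[OF postcomp_hom[of g Y X]] hom_zero[OF precomp_hom[of f Y Z]]
    hom_zero[OF tensor_left_hom[of g X Y]] hom_zero[OF tensor_right_hom[of g X Y]] by auto

lemma neg_zero [simp]: "\<lbrakk>X \<in> Obj C; Y \<in> Obj C\<rbrakk> \<Longrightarrow> neg (Zero C X Y) = Zero C X Y"
  using monoid.inv_one[OF comm_monoid.axioms(1)[OF comm_group.axioms(1)[OF hom_comm_group]], of X Y]
  by (simp add: neg_def arr_neg_def)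

lemma add_commute: "\<lbrakk>f \<in> Hom C X Y; g \<in> Hom C X Y\<rbrakk> \<Longrightarrow> Add C f g = Add C g f"
  using comm_monoid.m_comm[OF comm_group.axioms(1)[OF hom_comm_group], of X Y f g] Hom_obj
  by auto

lemma add_hom: "\<lbrakk>f \<in> Hom C X Y; g \<in> Hom C X Y\<rbrakk> \<Longrightarrow> Add C f g \<in> Hom C X Y"
  using monoid.m_closed[OF comm_monoid.axioms(1)[OF comm_group.axioms(1)[OF hom_comm_group]], of X Y f g] Hom_obj
  by auto

lemma arr_sum_zero:
  assumes "X \<in> Obj C" "Y \<in> Obj C" "\<And>i. i \<in> I \<Longrightarrow> f i = Zero C X Y"
  shows "arr_sum C X Y f I = Zero C X Y"
  using comm_monoid.finprod_one_eqI[OF comm_group.axioms(1)[OF hom_comm_group], of X Y I f] assms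
  by (simp add: arr_sum_def)

lemma arr_sum_reindex:
  assumes "X \<in> Obj C" "Y \<in> Obj C" "bij_betw h I J" "\<And>j. j \<in> J \<Longrightarrow> f j \<in> Hom C X Y"
  shows "arr_sum C X Y f J = arr_sum C X Y (\<lambda>i. f (h i)) I"
proof -
  have J: "J = h ` I" and inj: "inj_on h I" using assms(3) by (auto simp: bij_betw_def)
  show ?thesis
    using comm_monoid.finprod_reindex[OF comm_group.axioms(1)[OF hom_comm_group], of X Y f h I] assms inj
    by (auto simp: arr_sum_def J)
qed

end

section \<open>Arrows between tensor words\<close>

locale word_objects = additive_monoidal_category +
  fixes W :: "nat \<Rightarrow> 'a"
  assumes W_obj [simp]: "W k \<in> Obj C"
begin

abbreviation ob :: "nat list \<Rightarrow> 'a"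
  where "ob xs \<equiv> tensor_list C W xs"

lemma ob_Nil [simp]: "ob [] = unit C"
  by (simp add: tensor_list_def)

lemma ob_Cons: "ob (k # xs) = W k \<otimes>\<^sub>o ob xs"
  by (simp add: tensor_list_def)

lemma ob_obj [simp]: "ob xs \<in> Obj C"
  by (induct xs) (simp_all add: ob_Cons)

lemma ob_append [simp]: "ob xs \<otimes>\<^sub>o ob ys = ob (xs @ ys)"
  by (induct xs) (simp_all add: ob_Cons flip: tobj_assoc, simp add: ob_Cons)

lemma W_ob: "W k = ob [k]"
  by (simp add: ob_Cons)

definition whisker :: "nat list \<Rightarrow> 'b \<Rightarrow> nat list \<Rightarrow> 'b"
  where "whisker xs f ys = ident C (ob xs) \<otimes>\<^sub>a f \<otimes>\<^sub>a ident C (ob ys)"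

lemma whisker_arr [simp]: "f \<in> Arr C \<Longrightarrow> whisker xs f ys \<in> Arr C"
  and dom_whisker [simp]: "f \<in> Arr C \<Longrightarrow> Dom C (whisker xs f ys) = ob xs \<otimes>\<^sub>o Dom C f \<otimes>\<^sub>o ob ys"
  and cod_whisker [simp]: "f \<in> Arr C \<Longrightarrow> Cod C (whisker xs f ys) = ob xs \<otimes>\<^sub>o Cod C f \<otimes>\<^sub>o ob ys"
  by (simp_all add: whisker_def)

lemma ident_tarr_ident: "\<lbrakk>f \<in> Arr C; X \<in> Obj C; Y \<in> Obj C\<rbrakk>
    \<Longrightarrow> ident C X \<otimes>\<^sub>a (ident C Y \<otimes>\<^sub>a f) = ident C (X \<otimes>\<^sub>o Y) \<otimes>\<^sub>a f"
  by (simp flip: tarr_assoc del: tarr_assoc)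

lemma whisker_whisker [simp]:
  "f \<in> Arr C \<Longrightarrow> whisker xs (whisker xs' f ys') ys = whisker (xs @ xs') f (ys' @ ys)"
  by (simp add: whisker_def ident_tarr_ident)

lemma whisker_Nil [simp]: "f \<in> Arr C \<Longrightarrow> whisker [] f [] = f"
  by (simp add: whisker_def)

lemma whisker_ident [simp]: "whisker xs (ident C (ob zs)) ys = ident C (ob (xs @ zs @ ys))"
  by (simp add: whisker_def)

lemma whisker_comp [simp]:
  "\<lbrakk>f \<in> Arr C; g \<in> Arr C; Cod C f = Dom C g\<rbrakk>
    \<Longrightarrow> whisker xs (g \<cdot> f) ys = whisker xs g ys \<cdot> whisker xs f ys"
  by (simp add: whisker_def tarr_interchange)

lemma whisker_neg [simp]: "f \<in> Arr C \<Longrightarrow> whisker xs (neg f) ys = neg (whisker xs f ys)"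
  by (simp add: whisker_def)

text \<open>Arrows acting on disjoint parts of a word commute. All rearrangements below that are not instances of
  a braid or module relation come from this.\<close>

lemma whisker_interchange:
  assumes "f \<in> Arr C" "Dom C f = ob a" "Cod C f = ob a'" "g \<in> Arr C" "Dom C g = ob b" "Cod C g = ob b'"
  shows "whisker (xs @ a' @ ys) g zs \<cdot> whisker xs f (ys @ b @ zs)
       = whisker xs f (ys @ b' @ zs) \<cdot> whisker (xs @ a @ ys) g zs"
proof -
  have 1: "whisker (xs @ a @ ys) g zs = ident C (ob xs) \<otimes>\<^sub>a ident C (ob a) \<otimes>\<^sub>a whisker ys g zs" for a
    using assms by (simp add: whisker_def ident_tarr_ident)
  have 2: "whisker xs f (ys @ b @ zs) = ident C (ob xs) \<otimes>\<^sub>a f \<otimes>\<^sub>a ident C (ob (ys @ b @ zs))" for b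
    using assms by (simp add: whisker_def)
  show ?thesis unfolding 1 2 using assms by (simp add: tarr_interchange)
qed

end

section \<open>Moving a letter through a word\<close>

text \<open>A braided system with two modules, \<open>t\<close> standing for the negative of the braiding; this is where the
  signs in the two module relations come from. The right module is the letter \<open>0\<close>, the left one the
  letter \<open>Suc r\<close>. Typing is demanded for all indices, so that it never needs side conditions, the
  relations only for ordered letters of the system.\<close>

locale braided_words = word_objects +
  fixes r :: nat and t :: "nat \<Rightarrow> nat \<Rightarrow> 'b" and rho lam :: "nat \<Rightarrow> 'b"
  assumes t_hom: "t i j \<in> Hom C (ob [i, j]) (ob [j, i])"
    and rho_hom: "rho i \<in> Hom C (ob [0, i]) (ob [0])"
    and lam_hom: "lam i \<in> Hom C (ob [i, Suc r]) (ob [Suc r])"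
    and yang_baxter: "\<lbrakk>1 \<le> i; i \<le> j; j \<le> k; k \<le> r\<rbrakk> \<Longrightarrow>
      whisker [] (t j k) [i] \<cdot> whisker [j] (t i k) [] \<cdot> whisker [] (t i j) [k] =
      whisker [k] (t i j) [] \<cdot> whisker [] (t i k) [j] \<cdot> whisker [i] (t j k) []"
    and rho_rho: "\<lbrakk>1 \<le> i; i \<le> j; j \<le> r\<rbrakk> \<Longrightarrow>
      rho j \<cdot> whisker [] (rho i) [j] = neg (rho i \<cdot> whisker [] (rho j) [i] \<cdot> whisker [0] (t i j) [])"
    and lam_lam: "\<lbrakk>1 \<le> i; i \<le> j; j \<le> r\<rbrakk> \<Longrightarrow>
      lam i \<cdot> whisker [i] (lam j) [] =
      neg (lam j \<cdot> whisker [j] (lam i) [] \<cdot> whisker [] (t i j) [Suc r])"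
begin

lemma generators [simp]:
  "t i j \<in> Arr C" "Dom C (t i j) = ob [i, j]" "Cod C (t i j) = ob [j, i]"
  "rho i \<in> Arr C" "Dom C (rho i) = ob [0, i]" "Cod C (rho i) = ob [0]"
  "lam i \<in> Arr C" "Dom C (lam i) = ob [i, Suc r]" "Cod C (lam i) = ob [Suc r]"
  using t_hom rho_hom lam_hom by (auto simp: Hom_def)

abbreviation ordered :: "nat list \<Rightarrow> bool"
  where "ordered ks \<equiv> sorted ks \<and> set ks \<subseteq> {1..r}"

primrec move_left :: "nat list \<Rightarrow> nat \<Rightarrow> 'b" where
  "move_left [] x = ident C (ob [x])"
| "move_left (a # A) x = whisker [] (t a x) A \<cdot> whisker [a] (move_left A x) []"

primrec move_right :: "nat \<Rightarrow> nat list \<Rightarrow> 'b" where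
  "move_right x [] = ident C (ob [x])"
| "move_right x (b # B) = whisker [b] (move_right x B) [] \<cdot> whisker [] (t x b) B"

lemma move_left_typed [simp]:
  "move_left A x \<in> Arr C" "Dom C (move_left A x) = ob (A @ [x])" "Cod C (move_left A x) = ob (x # A)"
  by (induct A) simp_all

lemma move_right_typed [simp]:
  "move_right x B \<in> Arr C" "Dom C (move_right x B) = ob (x # B)" "Cod C (move_right x B) = ob (B @ [x])"
  by (induct B) simp_all

lemma move_left_append:
  "move_left (A @ B) x = whisker [] (move_left A x) B \<cdot> whisker A (move_left B x) []"
  by (induct A) simp_all

lemma move_right_append:
  "move_right x (A @ B) = whisker A (move_right x B) [] \<cdot> whisker [] (move_right x A) B"
  by (induct A) simp_all

text \<open>Induction on the middle word: its first letter \<open>b\<close> is split off, the hypothesis moves \<open>x\<close> and \<open>y\<close>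
  past each other across the rest, and the Yang-Baxter equation for \<open>x, b, y\<close> moves the crossing of \<open>x\<close>
  and \<open>y\<close> across \<open>b\<close>.\<close>

lemma yang_baxter_word:
  assumes "ordered (x # B @ [y])"
  shows "whisker [] (move_left B y) [x] \<cdot> whisker B (t x y) [] \<cdot> whisker [] (move_right x B) [y]
       = whisker [y] (move_right x B) [] \<cdot> whisker [] (t x y) B \<cdot> whisker [x] (move_left B y) []"
  using assms
proof (induct B)
  case (Cons b B)
  have IH: "whisker [b] (whisker [] (move_left B y) [x] \<cdot> whisker B (t x y) [] \<cdot> whisker [] (move_right x B) [y]) []
    = whisker [b] (whisker [y] (move_right x B) [] \<cdot> whisker [] (t x y) B \<cdot> whisker [x] (move_left B y) []) []"
    using Cons by simp
  have YB: "whisker [] (whisker [] (t b y) [x] \<cdot> whisker [b] (t x y) [] \<cdot> whisker [] (t x b) [y]) B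
    = whisker [] (whisker [y] (t x b) [] \<cdot> whisker [] (t x y) [b] \<cdot> whisker [x] (t b y) []) B"
    using Cons(2) yang_baxter[of x b y] by simp
  have 1: "whisker [] (t b y) (B @ [x]) \<cdot> whisker [b, y] (move_right x B) []
     = whisker [y, b] (move_right x B) [] \<cdot> whisker [] (t b y) (x # B)"
    using whisker_interchange[of "t b y" "[b, y]" "[y, b]" "move_right x B" "x # B" "B @ [x]" "[]" "[]" "[]"]
    by simp
  have 2: "whisker [] (t x b) (y # B) \<cdot> whisker [x, b] (move_left B y) []
     = whisker [b, x] (move_left B y) [] \<cdot> whisker [] (t x b) (B @ [y])"
    using whisker_interchange[of "t x b" "[x, b]" "[b, x]" "move_left B y" "B @ [y]" "y # B" "[]" "[]" "[]"]
    by simp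
  have "whisker [] (move_left (b # B) y) [x] \<cdot> whisker (b # B) (t x y) [] \<cdot> whisker [] (move_right x (b # B)) [y]
    = whisker [] (t b y) (B @ [x]) \<cdot>
      whisker [b] (whisker [] (move_left B y) [x] \<cdot> whisker B (t x y) [] \<cdot> whisker [] (move_right x B) [y]) [] \<cdot>
      whisker [] (t x b) (B @ [y])"
    by simp
  also have "\<dots> = (whisker [] (t b y) (B @ [x]) \<cdot> whisker [b, y] (move_right x B) []) \<cdot>
      whisker [b] (t x y) B \<cdot> (whisker [b, x] (move_left B y) [] \<cdot> whisker [] (t x b) (B @ [y]))"
    unfolding IH by simp
  also have "\<dots> = whisker [y, b] (move_right x B) [] \<cdot>
     whisker [] (whisker [] (t b y) [x] \<cdot> whisker [b] (t x y) [] \<cdot> whisker [] (t x b) [y]) B \<cdot>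
     whisker [x, b] (move_left B y) []"
    unfolding 1 2[symmetric] by simp
  also have "\<dots> = whisker [y] (move_right x (b # B)) [] \<cdot> whisker [] (t x y) (b # B) \<cdot>
     whisker [x] (move_left (b # B) y) []"
    unfolding YB by simp
  finally show ?case .
qed simp

section \<open>Deleting a letter by an action\<close>

definition act_right :: "nat list \<Rightarrow> nat \<Rightarrow> 'b"
  where "act_right A x = whisker [] (rho x) A \<cdot> whisker [0] (move_left A x) []"

definition act_left :: "nat \<Rightarrow> nat list \<Rightarrow> 'b"
  where "act_left x B = whisker B (lam x) [] \<cdot> whisker [] (move_right x B) [Suc r]"

lemma act_right_typed [simp]:
  "act_right A x \<in> Arr C" "Dom C (act_right A x) = ob (0 # A @ [x])" "Cod C (act_right A x) = ob (0 # A)"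
  by (simp_all add: act_right_def)

lemma act_left_typed [simp]:
  "act_left x B \<in> Arr C" "Dom C (act_left x B) = ob (x # B @ [Suc r])" "Cod C (act_left x B) = ob (B @ [Suc r])"
  by (simp_all add: act_left_def)

lemma act_right_append:
  "act_right (A @ B) x = whisker [] (act_right A x) B \<cdot> whisker (0 # A) (move_left B x) []"
  by (simp add: act_right_def move_left_append)

lemma act_left_append:
  "act_left x (A @ B) = whisker A (act_left x B) [] \<cdot> whisker [] (move_right x A) (B @ [Suc r])"
  by (simp add: act_left_def move_right_append)

text \<open>The object of the word \<open>0 # A\<close> carries the action \<open>act_right A\<close>, and this is the module relation for
  it. Adjoining a last letter \<open>a\<close> to \<open>A\<close> preserves the relation: the interchange law brings
  the three crossings of \<open>a\<close>, \<open>x\<close>, \<open>y\<close> together, and the Yang-Baxter equation reorders them.\<close>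

lemma act_right_anticommute:
  assumes "ordered (A @ [x, y])"
  shows "act_right A y \<cdot> whisker [] (act_right A x) [y]
       = neg (act_right A x \<cdot> whisker [] (act_right A y) [x] \<cdot> whisker (0 # A) (t x y) [])"
  using assms
proof (induct A rule: rev_induct)
  case Nil
  then show ?case using rho_rho[of x y] by (simp add: act_right_def)
next
  case (snoc a A)
  let ?p = "act_right A"
  have rec: "act_right (A @ [a]) z = whisker [] (?p z) [a] \<cdot> whisker (0 # A) (t a z) []" for z
    by (simp add: act_right_append)
  have IH: "whisker [] (?p y \<cdot> whisker [] (?p x) [y]) [a] =
     whisker [] (neg (?p x \<cdot> whisker [] (?p y) [x] \<cdot> whisker (0 # A) (t x y) [])) [a]"
    using snoc by (simp add: sorted_append)
  have YB: "whisker (0 # A) (whisker [] (t x y) [a] \<cdot> whisker [x] (t a y) [] \<cdot> whisker [] (t a x) [y]) []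
    = whisker (0 # A) (whisker [y] (t a x) [] \<cdot> whisker [] (t a y) [x] \<cdot> whisker [a] (t x y) []) []"
    using snoc(2) yang_baxter[of a x y] by (simp add: sorted_append)
  have comm: "whisker (0 # A) (t a z) [] \<cdot> whisker [] (?p w) [a, z]
     = whisker [] (?p w) [z, a] \<cdot> whisker (0 # A @ [w]) (t a z) []" for w z
    using whisker_interchange[of "?p w" "0 # A @ [w]" "0 # A" "t a z" "[a, z]" "[z, a]" "[]" "[]" "[]"]
    by simp
  have "act_right (A @ [a]) y \<cdot> whisker [] (act_right (A @ [a]) x) [y]
    = whisker [] (?p y) [a] \<cdot> (whisker (0 # A) (t a y) [] \<cdot> whisker [] (?p x) [a, y]) \<cdot>
      whisker (0 # A) (t a x) [y]"
    by (simp add: rec)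
  also have "\<dots> = whisker [] (?p y \<cdot> whisker [] (?p x) [y]) [a] \<cdot>
      whisker (0 # A @ [x]) (t a y) [] \<cdot> whisker (0 # A) (t a x) [y]"
    unfolding comm by simp
  also have "\<dots> = neg (whisker [] (?p x) [a] \<cdot> whisker [] (?p y) [x, a] \<cdot>
      whisker (0 # A) (whisker [] (t x y) [a] \<cdot> whisker [x] (t a y) [] \<cdot> whisker [] (t a x) [y]) [])"
    unfolding IH by simp
  also have "\<dots> = neg (whisker [] (?p x) [a] \<cdot> (whisker [] (?p y) [x, a] \<cdot>
      whisker (0 # A @ [y]) (t a x) []) \<cdot> whisker (0 # A) (t a y) [x] \<cdot> whisker (0 # A @ [a]) (t x y) [])"
    unfolding YB by simp
  also have "\<dots> = neg (act_right (A @ [a]) x \<cdot> whisker [] (act_right (A @ [a]) y) [x] \<cdot>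
      whisker (0 # A @ [a]) (t x y) [])"
    unfolding comm[symmetric] by (simp add: rec)
  finally show ?case .
qed

text \<open>The mirror image of \<open>act_right_anticommute\<close>: here the word grows at its first letter.\<close>

lemma act_left_anticommute:
  assumes "ordered (x # y # B)"
  shows "act_left x B \<cdot> whisker [x] (act_left y B) []
       = neg (act_left y B \<cdot> whisker [y] (act_left x B) [] \<cdot> whisker [] (t x y) (B @ [Suc r]))"
  using assms
proof (induct B)
  case Nil
  then show ?case using lam_lam[of x y] by (simp add: act_left_def)
next
  case (Cons b B)
  let ?q = "\<lambda>z. act_left z B" and ?S = "B @ [Suc r]"
  have rec: "act_left z (b # B) = whisker [b] (?q z) [] \<cdot> whisker [] (t z b) ?S" for z
    using act_left_append[of z "[b]" B] by simp
  have IH: "whisker [b] (?q x \<cdot> whisker [x] (?q y) []) [] =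
     whisker [b] (neg (?q y \<cdot> whisker [y] (?q x) [] \<cdot> whisker [] (t x y) ?S)) []"
    using Cons by simp
  have YB: "whisker [] (whisker [] (t y b) [x] \<cdot> whisker [y] (t x b) [] \<cdot> whisker [] (t x y) [b]) ?S
    = whisker [] (whisker [b] (t x y) [] \<cdot> whisker [] (t x b) [y] \<cdot> whisker [x] (t y b) []) ?S"
    using Cons(2) yang_baxter[of x y b] by simp
  have comm: "whisker [] (t z b) ?S \<cdot> whisker [z, b] (?q w) []
     = whisker [b, z] (?q w) [] \<cdot> whisker [] (t z b) (w # ?S)" for w z
    using whisker_interchange[of "t z b" "[z, b]" "[b, z]" "?q w" "w # ?S" ?S "[]" "[]" "[]"]
    by simp
  have "act_left x (b # B) \<cdot> whisker [x] (act_left y (b # B)) []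
    = whisker [b] (?q x) [] \<cdot> (whisker [] (t x b) ?S \<cdot> whisker [x, b] (?q y) []) \<cdot>
      whisker [x] (t y b) ?S"
    by (simp add: rec)
  also have "\<dots> = whisker [b] (?q x \<cdot> whisker [x] (?q y) []) [] \<cdot>
      whisker [] (t x b) (y # ?S) \<cdot> whisker [x] (t y b) ?S"
    unfolding comm by simp
  also have "\<dots> = neg (whisker [b] (?q y) [] \<cdot> whisker [b, y] (?q x) [] \<cdot>
      whisker [] (whisker [b] (t x y) [] \<cdot> whisker [] (t x b) [y] \<cdot> whisker [x] (t y b) []) ?S)"
    unfolding IH by simp
  also have "\<dots> = neg (whisker [b] (?q y) [] \<cdot> (whisker [b, y] (?q x) [] \<cdot>
      whisker [] (t y b) (x # ?S)) \<cdot> whisker [y] (t x b) ?S \<cdot> whisker [] (t x y) (b # ?S))"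
    unfolding YB[symmetric] by simp
  also have "\<dots> = neg (act_left y (b # B) \<cdot> whisker [y] (act_left x (b # B)) [] \<cdot>
      whisker [] (t x y) (b # ?S))"
    unfolding comm[symmetric] by (simp add: rec)
  finally show ?case by simp
qed

text \<open>Moving \<open>y\<close> through \<open>B\<close> does not interfere with the deletion of \<open>x\<close>, so only the module relation of
  \<open>act_right A\<close> is left to apply.\<close>

lemma act_right_act_right:
  assumes "ordered (A @ x # B @ [y])"
  shows "act_right (A @ B) y \<cdot> whisker [] (act_right A x) (B @ [y])
       = neg (whisker [] (act_right A x) B \<cdot> act_right (A @ x # B) y)"
proof -
  let ?p = "act_right A"
  have rel: "whisker [] (?p y \<cdot> whisker [] (?p x) [y]) B
     = whisker [] (neg (?p x \<cdot> whisker [] (?p y) [x] \<cdot> whisker (0 # A) (t x y) [])) B"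
    using assms by (subst act_right_anticommute) (auto simp: sorted_append)
  have comm: "whisker (0 # A) (move_left B y) [] \<cdot> whisker [] (?p x) (B @ [y])
     = whisker [] (?p x) (y # B) \<cdot> whisker (0 # A @ [x]) (move_left B y) []"
    using whisker_interchange[of "?p x" "0 # A @ [x]" "0 # A" "move_left B y" "B @ [y]" "y # B" "[]" "[]" "[]"]
    by simp
  have "act_right (A @ B) y \<cdot> whisker [] (?p x) (B @ [y])
      = whisker [] (?p y) B \<cdot> (whisker (0 # A) (move_left B y) [] \<cdot> whisker [] (?p x) (B @ [y]))"
    by (simp add: act_right_append)
  also have "\<dots> = whisker [] (?p y \<cdot> whisker [] (?p x) [y]) B \<cdot> whisker (0 # A @ [x]) (move_left B y) []"
    unfolding comm by simp
  also have "\<dots> = neg (whisker [] (?p x) B \<cdot> act_right (A @ x # B) y)"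
    unfolding rel by (simp add: act_right_append)
  finally show ?thesis .
qed

lemma act_left_act_left:
  assumes "ordered (x # B @ y # D)"
  shows "act_left x (B @ D) \<cdot> whisker (x # B) (act_left y D) []
       = neg (whisker B (act_left y D) [] \<cdot> act_left x (B @ y # D))"
proof -
  let ?q = "\<lambda>z. act_left z D" and ?S = "D @ [Suc r]"
  have rel: "whisker B (?q x \<cdot> whisker [x] (?q y) []) []
     = whisker B (neg (?q y \<cdot> whisker [y] (?q x) [] \<cdot> whisker [] (t x y) ?S)) []"
    using assms by (subst act_left_anticommute) (auto simp: sorted_append)
  have comm: "whisker [] (move_right x B) ?S \<cdot> whisker (x # B) (?q y) []
     = whisker (B @ [x]) (?q y) [] \<cdot> whisker [] (move_right x B) (y # ?S)"
    using whisker_interchange[of "move_right x B" "x # B" "B @ [x]" "?q y" "y # ?S" ?S "[]" "[]" "[]"]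
    by simp
  have "act_left x (B @ D) \<cdot> whisker (x # B) (?q y) []
      = whisker B (?q x) [] \<cdot> (whisker [] (move_right x B) ?S \<cdot> whisker (x # B) (?q y) [])"
    by (simp add: act_left_append)
  also have "\<dots> = whisker B (?q x \<cdot> whisker [x] (?q y) []) [] \<cdot> whisker [] (move_right x B) (y # ?S)"
    unfolding comm by simp
  also have "\<dots> = neg (whisker B (?q y) [] \<cdot> act_left x (B @ y # D))"
    unfolding rel using act_left_append[of x "[y]" D] by (simp add: act_left_append)
  finally show ?thesis .
qed

text \<open>The letter \<open>x\<close> goes to the right and \<open>y\<close>, standing behind it, to the left, so they have to cross. The interchange
  law pulls the two actions to the front; the crossings that remain are the two sides of
  \<open>yang_baxter_word\<close>.\<close>

lemma act_right_act_left:
  assumes "ordered (A @ x # B @ y # D)"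
  shows "whisker [] (act_right (A @ B) y) (D @ [Suc r]) \<cdot> whisker (0 # A) (act_left x (B @ y # D)) []
       = whisker (0 # A) (act_left x (B @ D)) [] \<cdot> whisker [] (act_right (A @ x # B) y) (D @ [Suc r])"
proof -
  let ?p = "act_right A y" and ?q = "act_left x D" and ?S = "D @ [Suc r]"
  have YB: "whisker (0 # A) (whisker [] (move_left B y) [x] \<cdot> whisker B (t x y) [] \<cdot> whisker [] (move_right x B) [y]) ?S
    = whisker (0 # A) (whisker [y] (move_right x B) [] \<cdot> whisker [] (t x y) B \<cdot> whisker [x] (move_left B y) []) ?S"
    using assms by (subst yang_baxter_word) (auto simp: sorted_append)
  have 1: "whisker (0 # A) (move_left B y) ?S \<cdot> whisker (0 # A @ B @ [y]) ?q []
     = whisker (0 # A @ y # B) ?q [] \<cdot> whisker (0 # A) (move_left B y) (x # ?S)"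
    using whisker_interchange[of "move_left B y" "B @ [y]" "y # B" ?q "x # ?S" ?S "0 # A" "[]" "[]"]
    by simp
  have 2: "whisker [] ?p (B @ ?S) \<cdot> whisker (0 # A @ y # B) ?q []
     = whisker (0 # A @ B) ?q [] \<cdot> whisker [] ?p (B @ x # ?S)"
    using whisker_interchange[of ?p "0 # A @ [y]" "0 # A" ?q "x # ?S" ?S "[]" B "[]"]
    by simp
  have 3: "whisker [] ?p (B @ x # ?S) \<cdot> whisker (0 # A @ [y]) (move_right x B) ?S
     = whisker (0 # A) (move_right x B) ?S \<cdot> whisker [] ?p (x # B @ ?S)"
    using whisker_interchange[of ?p "0 # A @ [y]" "0 # A" "move_right x B" "x # B" "B @ [x]" "[]" "[]" ?S]
    by simp
  have q: "act_left x (y # D) = whisker [y] ?q [] \<cdot> whisker [] (t x y) ?S"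
    using act_left_append[of x "[y]" D] by simp
  have p: "act_right (A @ [x]) y = whisker [] ?p [x] \<cdot> whisker (0 # A) (t x y) []"
    by (simp add: act_right_append)
  have "whisker [] (act_right (A @ B) y) ?S \<cdot> whisker (0 # A) (act_left x (B @ y # D)) []
     = whisker [] ?p (B @ ?S) \<cdot> (whisker (0 # A) (move_left B y) ?S \<cdot> whisker (0 # A @ B @ [y]) ?q []) \<cdot>
       whisker (0 # A @ B) (t x y) ?S \<cdot> whisker (0 # A) (move_right x B) (y # ?S)"
    by (simp add: act_left_append act_right_append q)
  also have "\<dots> = (whisker [] ?p (B @ ?S) \<cdot> whisker (0 # A @ y # B) ?q []) \<cdot>
      whisker (0 # A) (whisker [] (move_left B y) [x] \<cdot> whisker B (t x y) [] \<cdot> whisker [] (move_right x B) [y]) ?S"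
    unfolding 1 by simp
  also have "\<dots> = whisker (0 # A @ B) ?q [] \<cdot> (whisker [] ?p (B @ x # ?S) \<cdot>
      whisker (0 # A @ [y]) (move_right x B) ?S) \<cdot> whisker (0 # A) (t x y) (B @ ?S) \<cdot>
      whisker (0 # A @ [x]) (move_left B y) ?S"
    unfolding 2 YB by simp
  also have "\<dots> = whisker (0 # A) (act_left x (B @ D)) [] \<cdot> whisker [] (act_right (A @ x # B) y) ?S"
    unfolding 3 using act_right_append[of "A @ [x]" B y] by (simp add: act_left_append p)
  finally show ?thesis .
qed

end

section \<open>Deleting two letters\<close>

definition del :: "nat \<Rightarrow> 'i list \<Rightarrow> 'i list"
  where "del k ks = take k ks @ drop (Suc k) ks"

lemma del_ordered_words:
  assumes "ks \<in> ordered_words r (Suc n)" "k < Suc n"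
  shows "del k ks \<in> ordered_words r n"
proof -
  have ks: "ks = take k ks @ ks ! k # drop (Suc k) ks"
    using assms by (intro id_take_nth_drop) (auto simp: ordered_words_def)
  have "sorted (take k ks @ ks ! k # drop (Suc k) ks)"
    using assms ks by (simp add: ordered_words_def)
  then have "sorted (del k ks)" by (auto simp: del_def sorted_append)
  moreover have "set (del k ks) \<subseteq> set ks"
    unfolding del_def by (auto dest: in_set_takeD in_set_dropD)
  ultimately show ?thesis using assms by (auto simp: ordered_words_def del_def)
qed

lemma two_letters:
  assumes "length ks = Suc n" "k \<le> l" "l < n"
  obtains A x B y D where "ks = A @ x # B @ y # D" "k = length A" "l = length A + length B"
proof
  define A where "A = take k ks"
  define E where "E = drop (Suc k) ks"
  define B where "B = take (l - k) E"
  define D where "D = drop (Suc (l - k)) E"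
  have 1: "ks = A @ ks ! k # E" unfolding A_def E_def by (rule id_take_nth_drop) (use assms in auto)
  have 2: "E = B @ E ! (l - k) # D"
    unfolding B_def D_def by (rule id_take_nth_drop) (use assms in \<open>auto simp: E_def\<close>)
  show "ks = A @ ks ! k # B @ E ! (l - k) # D" using 1 2 by simp
  show "k = length A" "l = length A + length B"
    using assms by (auto simp: A_def B_def E_def)
qed

lemma del_del:
  assumes "length ks = Suc n" "k \<le> l" "l < n"
  shows "del l (del k ks) = del k (del (Suc l) ks)"
proof -
  obtain A x B y D where "ks = A @ x # B @ y # D" "k = length A" "l = length A + length B"
    using two_letters[OF assms] .
  then show ?thesis by (simp add: del_def)
qed

context braided_words
begin

definition del_right :: "nat \<Rightarrow> nat list \<Rightarrow> 'b"
  where "del_right k ks = whisker [] (act_right (take k ks) (ks ! k)) (drop (Suc k) ks @ [Suc r])"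

definition del_left :: "nat \<Rightarrow> nat list \<Rightarrow> 'b"
  where "del_left k ks = whisker (0 # take k ks) (act_left (ks ! k) (drop (Suc k) ks)) []"

lemma take_nth_drop_append:
  "k < length ks \<Longrightarrow> take k ks @ ks ! k # drop (Suc k) ks @ zs = ks @ zs"
  using id_take_nth_drop[of k ks] by (metis append_Cons append_assoc)

lemma del_right_hom:
  assumes "k < length ks"
  shows "del_right k ks \<in> Hom C (ob (0 # ks @ [Suc r])) (ob (0 # del k ks @ [Suc r]))"
  using assms by (simp add: Hom_def del_right_def del_def take_nth_drop_append)

lemma del_left_hom:
  assumes "k < length ks"
  shows "del_left k ks \<in> Hom C (ob (0 # ks @ [Suc r])) (ob (0 # del k ks @ [Suc r]))"
  using assms by (simp add: Hom_def del_left_def del_def take_nth_drop_append)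

text \<open>The letters at the positions \<open>k\<close> and \<open>l + 1\<close> are deleted in either order. After the deletion at \<open>k\<close>,
  the second letter stands at the position \<open>l\<close>.\<close>

lemma
  assumes "length ks = Suc n" "k \<le> l" "l < n" "ordered ks"
  shows del_right_del_right:
      "del_right l (del k ks) \<cdot> del_right k ks = neg (del_right k (del (Suc l) ks) \<cdot> del_right (Suc l) ks)"
    and del_left_del_left:
      "del_left l (del k ks) \<cdot> del_left k ks = neg (del_left k (del (Suc l) ks) \<cdot> del_left (Suc l) ks)"
    and del_left_del_right:
      "del_left l (del k ks) \<cdot> del_right k ks = del_right k (del (Suc l) ks) \<cdot> del_left (Suc l) ks"
    and del_right_del_left:
      "del_right l (del k ks) \<cdot> del_left k ks = del_left k (del (Suc l) ks) \<cdot> del_right (Suc l) ks"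
proof -
  obtain A x B y D where ks: "ks = A @ x # B @ y # D" "k = length A" "l = length A + length B"
    using two_letters[OF assms(1-3)] .
  have o: "ordered (A @ x # B @ [y])" "ordered (x # B @ y # D)" "ordered (A @ x # B @ y # D)"
    using assms(4) unfolding ks by (auto simp: sorted_append)
  have "(A @ x # B @ y # D) ! Suc (length A + length B) = y"
    using nth_append_length[of "A @ x # B" y D] by simp
  note simps = this ks del_def del_right_def del_left_def
  have "whisker [] (act_right (A @ B) y \<cdot> whisker [] (act_right A x) (B @ [y])) (D @ [Suc r])
     = whisker [] (neg (whisker [] (act_right A x) B \<cdot> act_right (A @ x # B) y)) (D @ [Suc r])"
    using act_right_act_right[OF o(1)] by simp
  then show "del_right l (del k ks) \<cdot> del_right k ks = neg (del_right k (del (Suc l) ks) \<cdot> del_right (Suc l) ks)"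
    by (simp add: simps)
  have "whisker (0 # A) (act_left x (B @ D) \<cdot> whisker (x # B) (act_left y D) []) []
     = whisker (0 # A) (neg (whisker B (act_left y D) [] \<cdot> act_left x (B @ y # D))) []"
    using act_left_act_left[OF o(2)] by simp
  then show "del_left l (del k ks) \<cdot> del_left k ks = neg (del_left k (del (Suc l) ks) \<cdot> del_left (Suc l) ks)"
    by (simp add: simps)
  show "del_right l (del k ks) \<cdot> del_left k ks = del_left k (del (Suc l) ks) \<cdot> del_right (Suc l) ks"
    using act_right_act_left[OF o(3)] by (simp add: simps)
  \<comment> \<open>the letter deleted to the left stands first: nothing crosses\<close>
  show "del_left l (del k ks) \<cdot> del_right k ks = del_right k (del (Suc l) ks) \<cdot> del_left (Suc l) ks"
    using whisker_interchange[of "act_right A x" "0 # A @ [x]" "0 # A" "act_left y D" "y # D @ [Suc r]" "D @ [Suc r]" "[]" B "[]"]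
    by (simp add: simps)
qed

end

section \<open>The differentials on the summands\<close>

text \<open>The given data \<open>V\<close>, \<open>\<tau>\<close>, \<open>\<rho>\<close>, \<open>lm\<close> are meaningful only for letters of the system; \<open>W\<close>, \<open>t\<close>, \<open>rho\<close>, \<open>lam\<close>
  are their extensions to all indices.\<close>

locale bidifferential_data = braided_words +
  fixes V :: "nat \<Rightarrow> 'a" and \<tau> :: "nat \<Rightarrow> nat \<Rightarrow> 'b" and \<rho> lm :: "nat \<Rightarrow> 'b"
    and T :: "nat \<Rightarrow> 'a" and incl proj :: "nat list \<Rightarrow> 'b"
  assumes V_W: "k \<in> {1..r} \<Longrightarrow> V k = W k"
    and \<tau>_t: "\<lbrakk>1 \<le> i; i \<le> j; j \<le> r\<rbrakk> \<Longrightarrow> \<tau> i j = t i j"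
    and \<rho>_rho: "i \<in> {1..r} \<Longrightarrow> \<rho> i = rho i"
    and lm_lam: "i \<in> {1..r} \<Longrightarrow> lm i = lam i"
    and powers: "ordered_tensor_powers C r V T incl proj"
begin

lemma tensor_list_V: "set ks \<subseteq> {1..r} \<Longrightarrow> tensor_list C V ks = ob ks"
  by (induct ks) (simp_all add: tensor_list_def V_W)

lemma
  assumes "ks \<in> ordered_words r n"
  shows incl_arr [simp]: "incl ks \<in> Arr C" and dom_incl [simp]: "Dom C (incl ks) = ob ks"
    and cod_incl: "Cod C (incl ks) = T n"
    and proj_arr [simp]: "proj ks \<in> Arr C" and dom_proj: "Dom C (proj ks) = T n"
    and cod_proj [simp]: "Cod C (proj ks) = ob ks"
  using powers assms tensor_list_V[of ks]
  by (auto simp: ordered_tensor_powers_def is_biproduct_def Hom_def ordered_words_def)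

lemma T_obj [simp]: "T n \<in> Obj C"
  using powers by (simp add: ordered_tensor_powers_def is_biproduct_def)

lemma finite_ordered_words: "finite (ordered_words r n)"
  using powers by (simp add: ordered_tensor_powers_def is_biproduct_def)

lemma proj_incl:
  assumes "ks \<in> ordered_words r n" "ls \<in> ordered_words r n"
  shows "proj ks \<cdot> incl ls = (if ks = ls then ident C (ob ks) else Zero C (ob ls) (ob ks))"
  using powers assms tensor_list_V[of ks] tensor_list_V[of ls]
  by (auto simp: ordered_tensor_powers_def is_biproduct_def ordered_words_def)

lemma incl_proj_sum:
  "arr_sum C (T n) (T n) (\<lambda>ks. incl ks \<cdot> proj ks) (ordered_words r n) = ident C (T n)"
  using powers by (simp add: ordered_tensor_powers_def is_biproduct_def)

definition MTN :: "nat \<Rightarrow> 'a"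
  where "MTN n = W 0 \<otimes>\<^sub>o T n \<otimes>\<^sub>o W (Suc r)"

definition summand :: "nat list \<Rightarrow> 'b"
  where "summand ks = ident C (W 0) \<otimes>\<^sub>a incl ks \<otimes>\<^sub>a ident C (W (Suc r))"

lemma MTN_obj [simp]: "MTN n \<in> Obj C"
  by (simp add: MTN_def)

lemma summand_hom:
  assumes "ks \<in> ordered_words r n"
  shows "summand ks \<in> Hom C (ob (0 # ks @ [Suc r])) (MTN n)"
  using assms by (simp add: Hom_def summand_def MTN_def cod_incl W_ob)

lemma summand_arr [simp]: "ks \<in> ordered_words r n \<Longrightarrow> summand ks \<in> Arr C"
  and dom_summand [simp]: "ks \<in> ordered_words r n \<Longrightarrow> Dom C (summand ks) = ob (0 # ks @ [Suc r])"
  and cod_summand: "ks \<in> ordered_words r n \<Longrightarrow> Cod C (summand ks) = MTN n"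
  using summand_hom[of ks n] by (auto simp: Hom_def)

lemma eq_on_summands:
  assumes f: "f \<in> Hom C (MTN n) Y" and g: "g \<in> Hom C (MTN n) Y"
    and eq: "\<And>ks. ks \<in> ordered_words r n \<Longrightarrow> f \<cdot> summand ks = g \<cdot> summand ks"
  shows "f = g"
proof -
  define pr where "pr ks = ident C (W 0) \<otimes>\<^sub>a proj ks \<otimes>\<^sub>a ident C (W (Suc r))" for ks
  have pr: "pr ks \<in> Arr C" "Dom C (pr ks) = MTN n" "Cod C (pr ks) = ob (0 # ks @ [Suc r])"
    if "ks \<in> ordered_words r n" for ks
    using that by (simp_all add: pr_def MTN_def W_ob dom_proj)
  have "ident C (MTN n) = arr_sum C (MTN n) (MTN n) (\<lambda>ks. summand ks \<cdot> pr ks) (ordered_words r n)"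
  proof -
    have "ident C (MTN n) = ident C (W 0) \<otimes>\<^sub>a ident C (T n) \<otimes>\<^sub>a ident C (W (Suc r))"
      by (simp add: MTN_def)
    also have "\<dots> = arr_sum C (MTN n) (MTN n)
        (\<lambda>ks. ident C (W 0) \<otimes>\<^sub>a (incl ks \<cdot> proj ks) \<otimes>\<^sub>a ident C (W (Suc r))) (ordered_words r n)"
      unfolding incl_proj_sum[symmetric]
      by (subst arr_sum_tarr, simp_all add: Hom_def cod_proj dom_proj cod_incl)
        (subst tarr_arr_sum, simp_all add: Hom_def dom_proj cod_incl MTN_def)
    also have "\<dots> = arr_sum C (MTN n) (MTN n) (\<lambda>ks. summand ks \<cdot> pr ks) (ordered_words r n)"
      by (intro arr_sum_cong)
        (simp_all add: Hom_def pr cod_summand, simp_all add: summand_def pr_def tarr_interchange)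
    finally show ?thesis .
  qed
  note id = this
  have expand: "h = arr_sum C (MTN n) Y (\<lambda>ks. (h \<cdot> summand ks) \<cdot> pr ks) (ordered_words r n)"
    if h: "h \<in> Hom C (MTN n) Y" for h
  proof -
    have "h = h \<cdot> ident C (MTN n)" using h by (simp add: Hom_def)
    also have "\<dots> = arr_sum C (MTN n) Y (\<lambda>ks. h \<cdot> (summand ks \<cdot> pr ks)) (ordered_words r n)"
      unfolding id using h
      by (subst comp_arr_sum) (auto simp: Hom_def pr cod_summand)
    also have "\<dots> = arr_sum C (MTN n) Y (\<lambda>ks. (h \<cdot> summand ks) \<cdot> pr ks) (ordered_words r n)"
      using h by (intro arr_sum_cong) (auto simp: Hom_def pr cod_summand)
    finally show ?thesis .
  qed
  have "f = arr_sum C (MTN n) Y (\<lambda>ks. (f \<cdot> summand ks) \<cdot> pr ks) (ordered_words r n)"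
    by (rule expand[OF f])
  also have "\<dots> = arr_sum C (MTN n) Y (\<lambda>ks. (g \<cdot> summand ks) \<cdot> pr ks) (ordered_words r n)"
    using f g by (intro arr_sum_cong) (auto simp: Hom_def pr cod_summand eq)
  also have "\<dots> = g" by (rule expand[OF g, symmetric])
  finally show ?thesis .
qed

definition deletion_family :: "(nat \<Rightarrow> nat list \<Rightarrow> 'b) \<Rightarrow> bool" where
  "deletion_family P \<longleftrightarrow>
     (\<forall>ks. \<forall>k<length ks. P k ks \<in> Hom C (ob (0 # ks @ [Suc r])) (ob (0 # del k ks @ [Suc r])))"

lemma deletion_familyD:
  "\<lbrakk>deletion_family P; k < length ks\<rbrakk>
    \<Longrightarrow> P k ks \<in> Hom C (ob (0 # ks @ [Suc r])) (ob (0 # del k ks @ [Suc r]))"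
  by (simp add: deletion_family_def)

text \<open>Composites of differentials depend only on their components on the summands, which are recorded
  here: the letter at each position \<open>k\<close> is deleted by means of \<open>P\<close>.\<close>

definition deletes :: "nat \<Rightarrow> 'b \<Rightarrow> (nat \<Rightarrow> nat list \<Rightarrow> 'b) \<Rightarrow> bool" where
  "deletes n d P \<longleftrightarrow> d \<in> Hom C (MTN (Suc n)) (MTN n) \<and>
     (\<forall>ks\<in>ordered_words r (Suc n). d \<cdot> summand ks =
        arr_sum C (ob (0 # ks @ [Suc r])) (MTN n) (\<lambda>k. summand (del k ks) \<cdot> P k ks) {..<Suc n})"

text \<open>Every pair of letters is deleted in both orders. The terms are grouped by pairs, so that a relation
  between the two orders applies to each bracket.\<close>

lemma deletes_comp:
  assumes d: "deletes n d P" and e: "deletes (Suc n) e Q"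
    and P: "deletion_family P"
    and Q: "deletion_family Q"
    and ks: "ks \<in> ordered_words r (Suc (Suc n))"
  shows "(d \<cdot> e) \<cdot> summand ks = arr_sum C (ob (0 # ks @ [Suc r])) (MTN n)
    (\<lambda>l. arr_sum C (ob (0 # ks @ [Suc r])) (MTN n)
      (\<lambda>k. Add C (summand (del l (del k ks)) \<cdot> P l (del k ks) \<cdot> Q k ks)
                 (summand (del k (del (Suc l) ks)) \<cdot> P k (del (Suc l) ks) \<cdot> Q (Suc l) ks)) {..l}) {..<Suc n}"
proof -
  have dh: "d \<in> Hom C (MTN (Suc n)) (MTN n)" and eh: "e \<in> Hom C (MTN (Suc (Suc n))) (MTN (Suc n))"
    using d e by (auto simp: deletes_def)
  have len: "length ks = Suc (Suc n)" using ks by (simp add: ordered_words_def)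
  have del1: "del k ks \<in> ordered_words r (Suc n)" if "k < Suc (Suc n)" for k
    using del_ordered_words[OF ks that] .
  have len1: "length (del k ks) = Suc n" if "k < Suc (Suc n)" for k
    using del1[OF that] by (simp add: ordered_words_def)
  have del2: "del l (del k ks) \<in> ordered_words r n" if "k < Suc (Suc n)" "l < Suc n" for k l
    using del_ordered_words[OF del1[OF that(1)] that(2)] .
  have Qk: "Q k ks \<in> Arr C" "Dom C (Q k ks) = ob (0 # ks @ [Suc r])" "Cod C (Q k ks) = ob (0 # del k ks @ [Suc r])"
    if "k < Suc (Suc n)" for k
    using deletion_familyD[OF Q, of k ks] that len by (auto simp: Hom_def)
  have Pl: "P l (del k ks) \<in> Arr C" "Dom C (P l (del k ks)) = ob (0 # del k ks @ [Suc r])"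
     "Cod C (P l (del k ks)) = ob (0 # del l (del k ks) @ [Suc r])"
    if "k < Suc (Suc n)" "l < Suc n" for k l
    using deletion_familyD[OF P, of l "del k ks"] that len1 by (auto simp: Hom_def)
  have summand1: "summand (del k ks) \<in> Arr C" "Dom C (summand (del k ks)) = ob (0 # del k ks @ [Suc r])"
      "Cod C (summand (del k ks)) = MTN (Suc n)" if "k < Suc (Suc n)" for k
    using summand_hom[OF del1[OF that]] by (simp_all add: Hom_def)
  have summand2: "summand (del l (del k ks)) \<in> Arr C" "Dom C (summand (del l (del k ks))) = ob (0 # del l (del k ks) @ [Suc r])"
      "Cod C (summand (del l (del k ks))) = MTN n" if "k < Suc (Suc n)" "l < Suc n" for k l
    using summand_hom[OF del2[OF that]] by (simp_all add: Hom_def)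
  note typed = Qk Pl summand1 summand2
  have "(d \<cdot> e) \<cdot> summand ks = d \<cdot> (e \<cdot> summand ks)"
    using dh eh ks by (simp add: Hom_def cod_summand)
  also have "e \<cdot> summand ks = arr_sum C (ob (0 # ks @ [Suc r])) (MTN (Suc n))
      (\<lambda>k. summand (del k ks) \<cdot> Q k ks) {..<Suc (Suc n)}"
    using e ks by (simp add: deletes_def)
  also have "d \<cdot> \<dots> = arr_sum C (ob (0 # ks @ [Suc r])) (MTN n)
      (\<lambda>k. d \<cdot> (summand (del k ks) \<cdot> Q k ks)) {..<Suc (Suc n)}"
    using dh by (subst comp_arr_sum) (auto simp: Hom_def typed simp del: lessThan_Suc)
  also have "\<dots> = arr_sum C (ob (0 # ks @ [Suc r])) (MTN n)
      (\<lambda>k. arr_sum C (ob (0 # ks @ [Suc r])) (MTN n)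
         (\<lambda>l. summand (del l (del k ks)) \<cdot> P l (del k ks) \<cdot> Q k ks) {..<Suc n}) {..<Suc (Suc n)}"
  proof (rule arr_sum_cong)
    fix k assume "k \<in> {..<Suc (Suc n)}"
    then have k: "k < Suc (Suc n)" by simp
    show "arr_sum C (ob (0 # ks @ [Suc r])) (MTN n)
         (\<lambda>l. summand (del l (del k ks)) \<cdot> P l (del k ks) \<cdot> Q k ks) {..<Suc n} \<in> Hom C (ob (0 # ks @ [Suc r])) (MTN n)"
      using k by (intro arr_sum_hom) (auto simp: Hom_def typed)
    have "d \<cdot> (summand (del k ks) \<cdot> Q k ks) = (d \<cdot> summand (del k ks)) \<cdot> Q k ks"
      using dh k by (simp add: Hom_def typed)
    also have "d \<cdot> summand (del k ks) = arr_sum C (ob (0 # del k ks @ [Suc r])) (MTN n)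
        (\<lambda>l. summand (del l (del k ks)) \<cdot> P l (del k ks)) {..<Suc n}"
      using d del1[OF k] by (simp add: deletes_def)
    also have "\<dots> \<cdot> Q k ks = arr_sum C (ob (0 # ks @ [Suc r])) (MTN n)
        (\<lambda>l. (summand (del l (del k ks)) \<cdot> P l (del k ks)) \<cdot> Q k ks) {..<Suc n}"
      using k by (subst arr_sum_comp) (auto simp: Hom_def typed simp del: lessThan_Suc)
    also have "\<dots> = arr_sum C (ob (0 # ks @ [Suc r])) (MTN n)
         (\<lambda>l. summand (del l (del k ks)) \<cdot> P l (del k ks) \<cdot> Q k ks) {..<Suc n}"
      using k by (intro arr_sum_cong) (auto simp: Hom_def typed)
    finally show "d \<cdot> (summand (del k ks) \<cdot> Q k ks) = \<dots>" .
  qed simp_all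
  also have "\<dots> = arr_sum C (ob (0 # ks @ [Suc r])) (MTN n)
    (\<lambda>l. arr_sum C (ob (0 # ks @ [Suc r])) (MTN n)
      (\<lambda>k. Add C (summand (del l (del k ks)) \<cdot> P l (del k ks) \<cdot> Q k ks)
                 (summand (del k (del (Suc l) ks)) \<cdot> P k (del (Suc l) ks) \<cdot> Q (Suc l) ks)) {..l}) {..<Suc n}"
    by (rule arr_sum_pair_deletions) (auto simp: Hom_def typed)
  finally show ?thesis .
qed

lemma deletes_square_zero:
  assumes d: "deletes n d P" and e: "deletes (Suc n) e P"
    and P: "deletion_family P"
    and PP: "\<And>ks k l. \<lbrakk>ks \<in> ordered_words r (Suc (Suc n)); k \<le> l; l < Suc n\<rbrakk> \<Longrightarrow>
       P l (del k ks) \<cdot> P k ks = neg (P k (del (Suc l) ks) \<cdot> P (Suc l) ks)"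
  shows "d \<cdot> e = Zero C (MTN (Suc (Suc n))) (MTN n)"
proof (rule eq_on_summands)
  have dh: "d \<in> Hom C (MTN (Suc n)) (MTN n)" and eh: "e \<in> Hom C (MTN (Suc (Suc n))) (MTN (Suc n))"
    using d e by (auto simp: deletes_def)
  then show "d \<cdot> e \<in> Hom C (MTN (Suc (Suc n))) (MTN n)" by (simp add: Hom_def)
  show "Zero C (MTN (Suc (Suc n))) (MTN n) \<in> Hom C (MTN (Suc (Suc n))) (MTN n)" by (simp add: Hom_def)
  fix ks assume ks: "ks \<in> ordered_words r (Suc (Suc n))"
  have len: "length ks = Suc (Suc n)" using ks by (simp add: ordered_words_def)
  have zero: "Add C (summand (del l (del k ks)) \<cdot> P l (del k ks) \<cdot> P k ks)
      (summand (del k (del (Suc l) ks)) \<cdot> P k (del (Suc l) ks) \<cdot> P (Suc l) ks)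
     = Zero C (ob (0 # ks @ [Suc r])) (MTN n)" if kl: "k \<le> l" "l < Suc n" for k l
  proof -
    have del1: "del (Suc l) ks \<in> ordered_words r (Suc n)"
      using del_ordered_words[OF ks] kl by simp
    then have del2: "del k (del (Suc l) ks) \<in> ordered_words r n"
      using del_ordered_words kl by simp
    define h where "h = P k (del (Suc l) ks) \<cdot> P (Suc l) ks"
    have h: "h \<in> Arr C" "Dom C h = ob (0 # ks @ [Suc r])" "Cod C h = ob (0 # del k (del (Suc l) ks) @ [Suc r])"
      using deletion_familyD[OF P, of "Suc l" ks] deletion_familyD[OF P, of k "del (Suc l) ks"] len del1 kl
      by (auto simp: h_def Hom_def ordered_words_def)
    show ?thesis
      unfolding del_del[OF len kl] PP[OF ks kl] h_def[symmetric]
      using h summand_hom[OF del2] by (simp add: Hom_def)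
  qed
  have "(d \<cdot> e) \<cdot> summand ks = Zero C (ob (0 # ks @ [Suc r])) (MTN n)"
    unfolding deletes_comp[OF d e P P ks] by (intro arr_sum_zero zero) auto
  then show "(d \<cdot> e) \<cdot> summand ks = Zero C (MTN (Suc (Suc n))) (MTN n) \<cdot> summand ks"
    using ks by (simp add: cod_summand)
qed

lemma deletes_commute:
  assumes d: "deletes n d P" and e: "deletes (Suc n) e Q"
    and d': "deletes n d' Q" and e': "deletes (Suc n) e' P"
    and P: "deletion_family P"
    and Q: "deletion_family Q"
    and PQ: "\<And>ks k l. \<lbrakk>ks \<in> ordered_words r (Suc (Suc n)); k \<le> l; l < Suc n\<rbrakk> \<Longrightarrow>
       P l (del k ks) \<cdot> Q k ks = Q k (del (Suc l) ks) \<cdot> P (Suc l) ks"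
    and QP: "\<And>ks k l. \<lbrakk>ks \<in> ordered_words r (Suc (Suc n)); k \<le> l; l < Suc n\<rbrakk> \<Longrightarrow>
       Q l (del k ks) \<cdot> P k ks = P k (del (Suc l) ks) \<cdot> Q (Suc l) ks"
  shows "d \<cdot> e = d' \<cdot> e'"
proof (rule eq_on_summands)
  show "d \<cdot> e \<in> Hom C (MTN (Suc (Suc n))) (MTN n)" "d' \<cdot> e' \<in> Hom C (MTN (Suc (Suc n))) (MTN n)"
    using d e d' e' by (auto simp: deletes_def Hom_def)
  fix ks assume ks: "ks \<in> ordered_words r (Suc (Suc n))"
  have len: "length ks = Suc (Suc n)" using ks by (simp add: ordered_words_def)
  have hom: "summand (del k (del (Suc l) ks)) \<cdot> F k (del (Suc l) ks) \<cdot> G (Suc l) ks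
     \<in> Hom C (ob (0 # ks @ [Suc r])) (MTN n)"
    if kl: "k \<le> l" "l < Suc n"
      and F: "deletion_family F" and G: "deletion_family G"
    for k l and F G :: "nat \<Rightarrow> nat list \<Rightarrow> 'b"
  proof -
    have del1: "del (Suc l) ks \<in> ordered_words r (Suc n)"
      using del_ordered_words[OF ks] kl by simp
    then have del2: "del k (del (Suc l) ks) \<in> ordered_words r n"
      using del_ordered_words kl by simp
    show ?thesis using deletion_familyD[OF G, of "Suc l" ks] deletion_familyD[OF F, of k "del (Suc l) ks"] len del1 kl summand_hom[OF del2]
      by (auto simp: Hom_def ordered_words_def)
  qed
  have pair: "Add C (summand (del l (del k ks)) \<cdot> P l (del k ks) \<cdot> Q k ks)
        (summand (del k (del (Suc l) ks)) \<cdot> P k (del (Suc l) ks) \<cdot> Q (Suc l) ks)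
     = Add C (summand (del l (del k ks)) \<cdot> Q l (del k ks) \<cdot> P k ks)
        (summand (del k (del (Suc l) ks)) \<cdot> Q k (del (Suc l) ks) \<cdot> P (Suc l) ks)"
    if kl: "k \<le> l" "l < Suc n" for k l
    unfolding del_del[OF len kl] PQ[OF ks kl] QP[OF ks kl]
    by (rule add_commute[OF hom[OF kl Q P] hom[OF kl P Q]])
  have add_mem: "Add C (summand (del l (del k ks)) \<cdot> Q l (del k ks) \<cdot> P k ks)
        (summand (del k (del (Suc l) ks)) \<cdot> Q k (del (Suc l) ks) \<cdot> P (Suc l) ks)
       \<in> Hom C (ob (0 # ks @ [Suc r])) (MTN n)" if kl: "k \<le> l" "l < Suc n" for k l
    unfolding del_del[OF len kl] QP[OF ks kl]
    by (rule add_hom[OF hom[OF kl P Q] hom[OF kl Q P]])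
  show "(d \<cdot> e) \<cdot> summand ks = (d' \<cdot> e') \<cdot> summand ks"
    unfolding deletes_comp[OF d e P Q ks] deletes_comp[OF d' e' Q P ks]
    by (intro arr_sum_cong arr_sum_hom add_mem pair) auto
qed

end

section \<open>The shuffle coproduct with a one-letter factor\<close>

context bidifferential_data
begin

lemma generator_whisker:
  assumes "set (D @ i # j # E) \<subseteq> {1..r}" "i \<le> j"
  shows "generator_arr C V \<tau> (Suc (length D)) (D @ i # j # E) = whisker D (t i j) E"
  using assms by (simp add: generator_arr_def whisker_def tensor_list_V \<tau>_t nth_append)

text \<open>Reading the word \<open>[Suc (length D)..<\<dots>]\<close> from its right end, the letter \<open>x\<close> passes the letters of \<open>A\<close>
  from the last to the first. Each crossing is defined since \<open>x\<close> is at least as large as every letter of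
  \<open>A\<close>.\<close>

lemma braid_act_left:
  "\<lbrakk>set (D @ A @ x # B) \<subseteq> {1..r}; \<And>a. a \<in> set A \<Longrightarrow> a \<le> x\<rbrakk> \<Longrightarrow>
   braid_act C V \<tau> [Suc (length D)..<Suc (length D + length A)] (D @ A @ x # B)
     = Some (D @ x # A @ B, whisker D (move_left A x) B)"
proof (induct A arbitrary: D)
  case Nil
  then show ?case by (simp add: tensor_list_V)
next
  case (Cons a A)
  have IH: "braid_act C V \<tau> [Suc (Suc (length D))..<Suc (length D + length (a # A))] (D @ (a # A) @ x # B)
      = Some (D @ a # x # A @ B, whisker (D @ [a]) (move_left A x) B)"
    using Cons(1)[of "D @ [a]"] Cons(2,3) by (simp del: upt_Suc)
  have upt: "[Suc (length D)..<Suc (length D + length (a # A))]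
      = Suc (length D) # [Suc (Suc (length D))..<Suc (length D + length (a # A))]"
    by (rule upt_conv_Cons) simp
  have gen: "generator_arr C V \<tau> (Suc (length D)) (D @ a # x # A @ B) = whisker D (t a x) (A @ B)"
    by (rule generator_whisker) (use Cons(2,3) in auto)
  show ?case unfolding upt braid_act.simps IH
    using Cons(3)[of a] by (simp add: gen nth_append list_update_append)
qed

lemma braid_act_right:
  "\<lbrakk>set (D @ x # B @ E) \<subseteq> {1..r}; \<And>b. b \<in> set B \<Longrightarrow> x \<le> b\<rbrakk> \<Longrightarrow>
   braid_act C V \<tau> (rev [Suc (length D)..<Suc (length D + length B)]) (D @ x # B @ E)
     = Some (D @ B @ x # E, whisker D (move_right x B) E)"
proof (induct B arbitrary: E rule: rev_induct)
  case Nil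
  then show ?case by (simp add: tensor_list_V)
next
  case (snoc b B)
  have IH: "braid_act C V \<tau> (rev [Suc (length D)..<Suc (length D + length B)]) (D @ x # (B @ [b]) @ E)
      = Some ((D @ B) @ x # b # E, whisker D (move_right x B) (b # E))"
    using snoc(1)[of "b # E"] snoc(2,3) by (simp del: upt_Suc)
  have upt: "rev [Suc (length D)..<Suc (length D + length (B @ [b]))]
      = Suc (length (D @ B)) # rev [Suc (length D)..<Suc (length D + length B)]"
    by simp
  have gen: "generator_arr C V \<tau> (Suc (length (D @ B))) ((D @ B) @ x # b # E) = whisker (D @ B) (t x b) E"
    by (rule generator_whisker) (use snoc(2,3) in auto)
  show ?case unfolding upt braid_act.simps IH
    using snoc(3)[of b] gen by (simp add: nth_append list_update_append move_right_append)
qed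

lemma split_at:
  assumes "ks \<in> ordered_words r (Suc q)" "k < Suc q"
  obtains A x B where "ks = A @ x # B" "k = length A" "q = length A + length B"
    "set (A @ x # B) \<subseteq> {1..r}" "\<And>a. a \<in> set A \<Longrightarrow> a \<le> x" "\<And>b. b \<in> set B \<Longrightarrow> x \<le> b"
    "[x] \<in> ordered_words r 1" "A @ B \<in> ordered_words r q"
proof -
  define A where "A = take k ks"
  define x where "x = ks ! k"
  define B where "B = drop (Suc k) ks"
  have len: "length ks = Suc q" and "set ks \<subseteq> {1..r}" "sorted ks"
    using assms(1) by (auto simp: ordered_words_def)
  have ks: "ks = A @ x # B"
    unfolding A_def x_def B_def using len assms(2) by (intro id_take_nth_drop) simp
  have "A @ B \<in> ordered_words r q"
    using del_ordered_words[OF assms] by (simp add: del_def A_def B_def)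
  moreover have "set (A @ x # B) \<subseteq> {1..r}" "sorted (A @ x # B)"
    using \<open>set ks \<subseteq> {1..r}\<close> \<open>sorted ks\<close> unfolding ks .
  moreover have "k = length A" "q = length A + length B"
    using len assms(2) by (auto simp: A_def B_def)
  ultimately show ?thesis
    using ks by (intro that) (auto simp: sorted_append ordered_words_def)
qed

definition left_term :: "nat \<Rightarrow> nat list \<Rightarrow> 'b" where
  "left_term k ks = (incl [ks ! k] \<otimes>\<^sub>a incl (del k ks)) \<cdot>
     whisker [] (move_left (take k ks) (ks ! k)) (drop (Suc k) ks)"

definition right_term :: "nat \<Rightarrow> nat list \<Rightarrow> 'b" where
  "right_term k ks = (incl (del k ks) \<otimes>\<^sub>a incl [ks ! k]) \<cdot>
     whisker (take k ks) (move_right (ks ! k) (drop (Suc k) ks)) []"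

lemma left_term_hom:
  assumes "ks \<in> ordered_words r (Suc q)" "k < Suc q"
  shows "left_term k ks \<in> Hom C (ob ks) (T 1 \<otimes>\<^sub>o T q)"
proof -
  obtain A x B where "ks = A @ x # B" "k = length A" "[x] \<in> ordered_words r 1" "A @ B \<in> ordered_words r q"
    using split_at[OF assms] by metis
  then show ?thesis by (simp add: left_term_def Hom_def del_def cod_incl[of "[x]" 1] cod_incl[of "A @ B" q])
qed

lemma right_term_hom:
  assumes "ks \<in> ordered_words r (Suc q)" "k < Suc q"
  shows "right_term k ks \<in> Hom C (ob ks) (T q \<otimes>\<^sub>o T 1)"
proof -
  obtain A x B where "ks = A @ x # B" "k = length A" "[x] \<in> ordered_words r 1" "A @ B \<in> ordered_words r q"
    using split_at[OF assms] by metis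
  then show ?thesis by (simp add: right_term_def Hom_def del_def cod_incl[of "[x]" 1] cod_incl[of "A @ B" q])
qed

lemma left_component:
  assumes "ks \<in> ordered_words r (Suc q)" "k < Suc q"
  shows "braid_component C V \<tau> incl 1
     (braid_word (1 + q) (inv_into UNIV (word_perm (rev [1..<Suc k])))) ks = left_term k ks"
proof -
  obtain A x B where ks: "ks = A @ x # B" "k = length A" "set ([] @ A @ x # B) \<subseteq> {1..r}"
      "\<And>a. a \<in> set A \<Longrightarrow> a \<le> x"
    using split_at[OF assms] by (metis append_Nil)
  have "braid_word (1 + q) (inv_into UNIV (word_perm (rev [1..<Suc k]))) = [1..<Suc k]"
    using assms(2) by (simp add: inv_word_perm braid_word_up del: upt_Suc)
  then show ?thesis
    using braid_act_left[OF ks(3,4)] by (simp add: ks braid_component_def left_term_def del_def del: upt_Suc)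
qed

lemma right_component:
  assumes "ks \<in> ordered_words r (Suc q)" "k < Suc q"
  shows "braid_component C V \<tau> incl q
     (braid_word (q + 1) (inv_into UNIV (word_perm [Suc k..<Suc q]))) ks = right_term k ks"
proof -
  obtain A x B where ks: "ks = A @ x # B" "k = length A" "q = length A + length B"
      "set (A @ x # B @ []) \<subseteq> {1..r}" "\<And>b. b \<in> set B \<Longrightarrow> x \<le> b"
    using split_at[OF assms] by (metis append_Nil2)
  have "braid_word (q + 1) (inv_into UNIV (word_perm [Suc k..<Suc q])) = rev [Suc k..<Suc q]"
    using assms(2) by (simp add: inv_word_perm braid_word_down del: upt_Suc)
  then show ?thesis
    using braid_act_right[OF ks(4,5)] by (simp add: ks braid_component_def right_term_def del_def del: upt_Suc)
qed

text \<open>The double sum in the coproduct, over shuffles and summands, collapses to the sum over shuffles on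
  each summand. The shuffles are numbered by the position of the letter that they move.\<close>

lemma coproduct_incl:
  assumes bij: "bij_betw \<theta> {..<Suc n} (Sh p q)" and n: "Suc n = p + q"
    and comp: "\<And>ks k. \<lbrakk>ks \<in> ordered_words r (Suc n); k < Suc n\<rbrakk> \<Longrightarrow>
        braid_component C V \<tau> incl p (braid_word (p + q) (inv_into UNIV (\<theta> k))) ks = c k ks"
    and c: "\<And>ks k. \<lbrakk>ks \<in> ordered_words r (Suc n); k < Suc n\<rbrakk> \<Longrightarrow> c k ks \<in> Hom C (ob ks) (T p \<otimes>\<^sub>o T q)"
  shows "shuffle_coproduct C r V \<tau> T incl proj p q \<in> Hom C (T (Suc n)) (T p \<otimes>\<^sub>o T q)"
    and "ks \<in> ordered_words r (Suc n) \<Longrightarrow> shuffle_coproduct C r V \<tau> T incl proj p q \<cdot> incl ks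
      = arr_sum C (ob ks) (T p \<otimes>\<^sub>o T q) (\<lambda>k. c k ks) {..<Suc n}"
proof -
  let ?Y = "T p \<otimes>\<^sub>o T q" and ?w = "ordered_words r (Suc n)"
  let ?b = "\<lambda>\<theta> ks. braid_component C V \<tau> incl p (braid_word (p + q) (inv_into UNIV \<theta>)) ks"
  have cp: "c k ks \<cdot> proj ks \<in> Hom C (T (Suc n)) ?Y" if "ks \<in> ?w" "k < Suc n" for k ks
    using c[OF that] that by (simp add: Hom_def dom_proj)
  have inner: "arr_sum C (T (Suc n)) ?Y (\<lambda>ks. c k ks \<cdot> proj ks) ?w \<in> Hom C (T (Suc n)) ?Y"
    if "k < Suc n" for k using cp that by (intro arr_sum_hom) auto
  have conv: "arr_sum C (T (Suc n)) ?Y (\<lambda>ks. ?b (\<theta> k) ks \<cdot> proj ks) ?w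
      = arr_sum C (T (Suc n)) ?Y (\<lambda>ks. c k ks \<cdot> proj ks) ?w" if "k < Suc n" for k
    by (rule arr_sum_cong) (use cp comp that in auto)
  have "shuffle_coproduct C r V \<tau> T incl proj p q
      = arr_sum C (T (Suc n)) ?Y
          (\<lambda>k. arr_sum C (T (Suc n)) ?Y (\<lambda>ks. ?b (\<theta> k) ks \<cdot> proj ks) ?w) {..<Suc n}"
    unfolding shuffle_coproduct_def n[symmetric]
  proof (rule arr_sum_reindex[OF _ _ bij])
    fix \<eta> assume "\<eta> \<in> Sh p q"
    then obtain k where "k < Suc n" "\<eta> = \<theta> k" using bij by (auto simp: bij_betw_def)
    then show "arr_sum C (T (Suc n)) ?Y (\<lambda>ks. braid_component C V \<tau> incl p (braid_word (Suc n) (inv_into UNIV \<eta>)) ks \<cdot> proj ks) ?w \<in> Hom C (T (Suc n)) ?Y"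
      using conv inner n by simp
  qed simp_all
  also have "\<dots> = arr_sum C (T (Suc n)) ?Y
          (\<lambda>k. arr_sum C (T (Suc n)) ?Y (\<lambda>ks. c k ks \<cdot> proj ks) ?w) {..<Suc n}"
    by (rule arr_sum_cong) (use conv inner in auto)
  finally have eq: "shuffle_coproduct C r V \<tau> T incl proj p q = \<dots>" .
  show "shuffle_coproduct C r V \<tau> T incl proj p q \<in> Hom C (T (Suc n)) ?Y"
    unfolding eq by (rule arr_sum_hom) (use inner in auto)
  assume ks: "ks \<in> ?w"
  have "shuffle_coproduct C r V \<tau> T incl proj p q \<cdot> incl ks
      = arr_sum C (ob ks) ?Y (\<lambda>k. arr_sum C (T (Suc n)) ?Y (\<lambda>ks. c k ks \<cdot> proj ks) ?w \<cdot> incl ks) {..<Suc n}"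
    unfolding eq using ks inner by (subst arr_sum_comp) (auto simp: cod_incl simp del: lessThan_Suc)
  also have "\<dots> = arr_sum C (ob ks) ?Y (\<lambda>k. c k ks) {..<Suc n}"
  proof (rule arr_sum_cong)
    fix k assume "k \<in> {..<Suc n}"
    then have k: "k < Suc n" by simp
    show "c k ks \<in> Hom C (ob ks) ?Y" by (rule c[OF ks k])
    have summand_eq: "(c k ls \<cdot> proj ls) \<cdot> incl ks = (if ls = ks then c k ks else Zero C (ob ks) ?Y)"
      if "ls \<in> ?w" for ls
      using c[OF that k] that ks by (auto simp: Hom_def dom_proj cod_incl proj_incl)
    have "arr_sum C (T (Suc n)) ?Y (\<lambda>ks. c k ks \<cdot> proj ks) ?w \<cdot> incl ks
        = arr_sum C (ob ks) ?Y (\<lambda>ls. (c k ls \<cdot> proj ls) \<cdot> incl ks) ?w"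
      using cp k ks by (subst arr_sum_comp) (auto simp: cod_incl)
    also have "\<dots> = (c k ks \<cdot> proj ks) \<cdot> incl ks"
      using finite_ordered_words ks summand_eq c[OF ks k] by (intro arr_sum_delta) auto
    also have "\<dots> = c k ks" using summand_eq ks by simp
    finally show "arr_sum C (T (Suc n)) ?Y (\<lambda>ks. c k ks \<cdot> proj ks) ?w \<cdot> incl ks = c k ks" .
  qed simp_all
  finally show "shuffle_coproduct C r V \<tau> T incl proj p q \<cdot> incl ks
      = arr_sum C (ob ks) ?Y (\<lambda>k. c k ks) {..<Suc n}" .
qed

lemma singleton_word: "i \<in> {1..r} \<Longrightarrow> [i] \<in> ordered_words r 1"
  by (simp add: ordered_words_def)

lemma
  assumes "i \<in> {1..r}"
  shows right_action_summand: "\<rho> i \<cdot> (ident C (W 0) \<otimes>\<^sub>a proj [i]) \<in> Hom C (W 0 \<otimes>\<^sub>o T 1) (W 0)"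
    and left_action_summand:
      "lm i \<cdot> (proj [i] \<otimes>\<^sub>a ident C (W (Suc r))) \<in> Hom C (T 1 \<otimes>\<^sub>o W (Suc r)) (W (Suc r))"
  using singleton_word[OF assms] assms by (simp_all add: Hom_def \<rho>_rho lm_lam dom_proj W_ob)

lemma right_action_hom: "right_action C r T proj (W 0) \<rho> \<in> Hom C (W 0 \<otimes>\<^sub>o T 1) (W 0)"
  unfolding right_action_def by (rule arr_sum_hom[OF _ _ right_action_summand]) simp_all

lemma left_action_hom: "left_action C r T proj (W (Suc r)) lm \<in> Hom C (T 1 \<otimes>\<^sub>o W (Suc r)) (W (Suc r))"
  unfolding left_action_def by (rule arr_sum_hom[OF _ _ left_action_summand]) simp_all

lemma right_action_incl:
  assumes "x \<in> {1..r}"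
  shows "right_action C r T proj (W 0) \<rho> \<cdot> (ident C (W 0) \<otimes>\<^sub>a incl [x]) = rho x"
proof -
  note x = singleton_word[OF assms]
  let ?i = "ident C (W 0) \<otimes>\<^sub>a incl [x]"
  have i: "?i \<in> Arr C" "Dom C ?i = ob [0, x]" "Cod C ?i = W 0 \<otimes>\<^sub>o T 1"
    using x by (simp_all add: cod_incl W_ob)
  have summand_eq: "(\<rho> j \<cdot> (ident C (W 0) \<otimes>\<^sub>a proj [j])) \<cdot> ?i = (if j = x then rho x else Zero C (ob [0, x]) (W 0))"
    if j: "j \<in> {1..r}" for j
  proof -
    note jw = singleton_word[OF j]
    have "(\<rho> j \<cdot> (ident C (W 0) \<otimes>\<^sub>a proj [j])) \<cdot> ?i = rho j \<cdot> (ident C (W 0) \<otimes>\<^sub>a (proj [j] \<cdot> incl [x]))"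
      using jw x j by (simp add: \<rho>_rho W_ob dom_proj cod_incl tarr_interchange)
    also have "\<dots> = (if j = x then rho x else Zero C (ob [0, x]) (W 0))"
      using jw x by (simp add: proj_incl W_ob)
    finally show ?thesis .
  qed
  have "right_action C r T proj (W 0) \<rho> \<cdot> ?i
      = arr_sum C (ob [0, x]) (W 0) (\<lambda>j. (\<rho> j \<cdot> (ident C (W 0) \<otimes>\<^sub>a proj [j])) \<cdot> ?i) {1..r}"
    unfolding right_action_def i(2)[symmetric]
    by (rule arr_sum_comp[OF i(1,3) _ right_action_summand]) simp_all
  also have "\<dots> = (\<rho> x \<cdot> (ident C (W 0) \<otimes>\<^sub>a proj [x])) \<cdot> ?i"
    using assms summand_eq by (intro arr_sum_delta) (simp_all add: Hom_def W_ob)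
  also have "\<dots> = rho x" using summand_eq[OF assms] by simp
  finally show ?thesis .
qed

lemma left_action_incl:
  assumes "x \<in> {1..r}"
  shows "left_action C r T proj (W (Suc r)) lm \<cdot> (incl [x] \<otimes>\<^sub>a ident C (W (Suc r))) = lam x"
proof -
  note x = singleton_word[OF assms]
  let ?N = "W (Suc r)"
  let ?i = "incl [x] \<otimes>\<^sub>a ident C ?N"
  have i: "?i \<in> Arr C" "Dom C ?i = ob [x, Suc r]" "Cod C ?i = T 1 \<otimes>\<^sub>o ?N"
    using x by (simp_all add: cod_incl W_ob)
  have summand_eq: "(lm j \<cdot> (proj [j] \<otimes>\<^sub>a ident C ?N)) \<cdot> ?i = (if j = x then lam x else Zero C (ob [x, Suc r]) ?N)"
    if j: "j \<in> {1..r}" for j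
  proof -
    note jw = singleton_word[OF j]
    have "(lm j \<cdot> (proj [j] \<otimes>\<^sub>a ident C ?N)) \<cdot> ?i = lam j \<cdot> ((proj [j] \<cdot> incl [x]) \<otimes>\<^sub>a ident C ?N)"
      using jw x j by (simp add: lm_lam W_ob dom_proj cod_incl tarr_interchange)
    also have "\<dots> = (if j = x then lam x else Zero C (ob [x, Suc r]) ?N)"
      using jw x by (simp add: proj_incl W_ob)
    finally show ?thesis .
  qed
  have "left_action C r T proj ?N lm \<cdot> ?i
      = arr_sum C (ob [x, Suc r]) ?N (\<lambda>j. (lm j \<cdot> (proj [j] \<otimes>\<^sub>a ident C ?N)) \<cdot> ?i) {1..r}"
    unfolding left_action_def i(2)[symmetric]
    by (rule arr_sum_comp[OF i(1,3) _ left_action_summand]) simp_all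
  also have "\<dots> = (lm x \<cdot> (proj [x] \<otimes>\<^sub>a ident C ?N)) \<cdot> ?i"
    using assms summand_eq by (intro arr_sum_delta) (simp_all add: Hom_def W_ob)
  also have "\<dots> = lam x" using summand_eq[OF assms] by simp
  finally show ?thesis .
qed

lemma sandwich_comp:
  "\<lbrakk>f \<in> Arr C; g \<in> Arr C; Cod C f = Dom C g; Y \<in> Obj C; Z \<in> Obj C\<rbrakk> \<Longrightarrow>
   ident C Y \<otimes>\<^sub>a (g \<cdot> f) \<otimes>\<^sub>a ident C Z
     = (ident C Y \<otimes>\<^sub>a g \<otimes>\<^sub>a ident C Z) \<cdot> (ident C Y \<otimes>\<^sub>a f \<otimes>\<^sub>a ident C Z)"
  by (simp add: tarr_interchange)

text \<open>Both differentials consist of a coproduct \<open>h\<close> tensored with the coefficients, followed by an action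
  \<open>g\<close>; the sums pass through by additivity.\<close>

lemma deletes_sandwich:
  assumes g: "g \<in> Arr C" "Dom C g = W 0 \<otimes>\<^sub>o Z \<otimes>\<^sub>o W (Suc r)" "Cod C g = MTN n"
    and h: "h \<in> Hom C (T (Suc n)) Z" and Z: "Z \<in> Obj C"
    and hc: "\<And>ks. ks \<in> ordered_words r (Suc n) \<Longrightarrow> h \<cdot> incl ks = arr_sum C (ob ks) Z (\<lambda>k. c k ks) {..<Suc n}"
    and c: "\<And>ks k. \<lbrakk>ks \<in> ordered_words r (Suc n); k < Suc n\<rbrakk> \<Longrightarrow> c k ks \<in> Hom C (ob ks) Z"
    and P: "\<And>ks k. \<lbrakk>ks \<in> ordered_words r (Suc n); k < Suc n\<rbrakk> \<Longrightarrow>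
       g \<cdot> (ident C (W 0) \<otimes>\<^sub>a c k ks \<otimes>\<^sub>a ident C (W (Suc r))) = summand (del k ks) \<cdot> P k ks"
  shows "deletes n (g \<cdot> (ident C (W 0) \<otimes>\<^sub>a h \<otimes>\<^sub>a ident C (W (Suc r)))) P"
  unfolding deletes_def
proof (intro conjI ballI)
  let ?M = "W 0" and ?N = "W (Suc r)"
  show "g \<cdot> (ident C ?M \<otimes>\<^sub>a h \<otimes>\<^sub>a ident C ?N) \<in> Hom C (MTN (Suc n)) (MTN n)"
    using g h by (simp add: Hom_def MTN_def)
  fix ks assume ks: "ks \<in> ordered_words r (Suc n)"
  have "(g \<cdot> (ident C ?M \<otimes>\<^sub>a h \<otimes>\<^sub>a ident C ?N)) \<cdot> summand ks
      = g \<cdot> (ident C ?M \<otimes>\<^sub>a (h \<cdot> incl ks) \<otimes>\<^sub>a ident C ?N)"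
    using g h ks by (simp add: Hom_def summand_def cod_incl tarr_interchange)
  also have "ident C ?M \<otimes>\<^sub>a (h \<cdot> incl ks) \<otimes>\<^sub>a ident C ?N
      = ident C ?M \<otimes>\<^sub>a arr_sum C (ob (ks @ [Suc r])) (Z \<otimes>\<^sub>o ?N) (\<lambda>k. c k ks \<otimes>\<^sub>a ident C ?N) {..<Suc n}"
    unfolding hc[OF ks] using c[OF ks] Z by (subst arr_sum_tarr) (simp_all add: W_ob del: lessThan_Suc)
  also have "\<dots> = arr_sum C (ob (0 # ks @ [Suc r])) (?M \<otimes>\<^sub>o Z \<otimes>\<^sub>o ?N)
      (\<lambda>k. ident C ?M \<otimes>\<^sub>a c k ks \<otimes>\<^sub>a ident C ?N) {..<Suc n}"
    using c[OF ks] Z by (subst tarr_arr_sum) (simp_all add: Hom_def W_ob del: lessThan_Suc)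
  also have "g \<cdot> \<dots> = arr_sum C (ob (0 # ks @ [Suc r])) (MTN n)
      (\<lambda>k. g \<cdot> (ident C ?M \<otimes>\<^sub>a c k ks \<otimes>\<^sub>a ident C ?N)) {..<Suc n}"
    using c[OF ks] Z g by (subst comp_arr_sum) (simp_all add: Hom_def W_ob del: lessThan_Suc)
  also have "\<dots> = arr_sum C (ob (0 # ks @ [Suc r])) (MTN n) (\<lambda>k. summand (del k ks) \<cdot> P k ks) {..<Suc n}"
  proof (rule arr_sum_cong)
    fix k assume "k \<in> {..<Suc n}"
    then have k: "k < Suc n" by simp
    show "g \<cdot> (ident C ?M \<otimes>\<^sub>a c k ks \<otimes>\<^sub>a ident C ?N) = summand (del k ks) \<cdot> P k ks"
      by (rule P[OF ks k])
    show "summand (del k ks) \<cdot> P k ks \<in> Hom C (ob (0 # ks @ [Suc r])) (MTN n)"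
      unfolding P[OF ks k, symmetric] using c[OF ks k] g by (simp add: Hom_def W_ob)
  qed simp_all
  finally show "(g \<cdot> (ident C ?M \<otimes>\<^sub>a h \<otimes>\<^sub>a ident C ?N)) \<cdot> summand ks = \<dots>" .
qed

text \<open>The arrow \<open>d_right n\<close> starts in degree \<open>n + 1\<close>, which avoids truncated subtraction. In \<open>d_left\<close> the sign of the
  differential is left out, so that the two families commute.\<close>

definition d_right :: "nat \<Rightarrow> 'b" where
  "d_right n = (right_action C r T proj (W 0) \<rho> \<otimes>\<^sub>a ident C (T n \<otimes>\<^sub>o W (Suc r))) \<cdot>
     (ident C (W 0) \<otimes>\<^sub>a shuffle_coproduct C r V \<tau> T incl proj 1 n \<otimes>\<^sub>a ident C (W (Suc r)))"

definition d_left :: "nat \<Rightarrow> 'b" where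
  "d_left n = (ident C (W 0 \<otimes>\<^sub>o T n) \<otimes>\<^sub>a left_action C r T proj (W (Suc r)) lm) \<cdot>
     (ident C (W 0) \<otimes>\<^sub>a shuffle_coproduct C r V \<tau> T incl proj n 1 \<otimes>\<^sub>a ident C (W (Suc r)))"

lemma d_right_deletes: "deletes n (d_right n) del_right"
  unfolding d_right_def
proof (rule deletes_sandwich[where Z = "T 1 \<otimes>\<^sub>o T n" and c = left_term])
  let ?M = "W 0" and ?N = "W (Suc r)" and ?ra = "right_action C r T proj (W 0) \<rho>"
  have ra: "?ra \<in> Arr C" "Dom C ?ra = ?M \<otimes>\<^sub>o T 1" "Cod C ?ra = ?M"
    using right_action_hom by (simp_all add: Hom_def)
  then show "?ra \<otimes>\<^sub>a ident C (T n \<otimes>\<^sub>o ?N) \<in> Arr C"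
    "Dom C (?ra \<otimes>\<^sub>a ident C (T n \<otimes>\<^sub>o ?N)) = ?M \<otimes>\<^sub>o (T 1 \<otimes>\<^sub>o T n) \<otimes>\<^sub>o ?N"
    "Cod C (?ra \<otimes>\<^sub>a ident C (T n \<otimes>\<^sub>o ?N)) = MTN n"
    by (simp_all add: MTN_def)
  show "T 1 \<otimes>\<^sub>o T n \<in> Obj C" by simp
  show "shuffle_coproduct C r V \<tau> T incl proj 1 n \<in> Hom C (T (Suc n)) (T 1 \<otimes>\<^sub>o T n)"
    by (rule coproduct_incl(1)[OF shuffles_one_left _ left_component left_term_hom]) simp_all
  fix ks assume ks: "ks \<in> ordered_words r (Suc n)"
  show "shuffle_coproduct C r V \<tau> T incl proj 1 n \<cdot> incl ks
      = arr_sum C (ob ks) (T 1 \<otimes>\<^sub>o T n) (\<lambda>k. left_term k ks) {..<Suc n}"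
    by (rule coproduct_incl(2)[OF shuffles_one_left _ left_component left_term_hom]) (simp_all add: ks)
  fix k assume k: "k < Suc n"
  show "left_term k ks \<in> Hom C (ob ks) (T 1 \<otimes>\<^sub>o T n)" by (rule left_term_hom[OF ks k])
  obtain A x B where kA: "ks = A @ x # B" "k = length A" "set (A @ x # B) \<subseteq> {1..r}"
     and w: "[x] \<in> ordered_words r 1" "A @ B \<in> ordered_words r n"
    using split_at[OF ks k] by metis
  have x: "x \<in> {1..r}" using kA(3) by simp
  have "left_term k ks = (incl [x] \<otimes>\<^sub>a incl (A @ B)) \<cdot> whisker [] (move_left A x) B"
    by (simp add: left_term_def kA del_def)
  moreover have "ident C ?M \<otimes>\<^sub>a ((incl [x] \<otimes>\<^sub>a incl (A @ B)) \<cdot> whisker [] (move_left A x) B) \<otimes>\<^sub>a ident C ?N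
      = (ident C ?M \<otimes>\<^sub>a (incl [x] \<otimes>\<^sub>a incl (A @ B)) \<otimes>\<^sub>a ident C ?N) \<cdot> (ident C ?M \<otimes>\<^sub>a whisker [] (move_left A x) B \<otimes>\<^sub>a ident C ?N)"
    by (rule sandwich_comp) (use w in simp_all)
  moreover have "ident C ?M \<otimes>\<^sub>a whisker [] (move_left A x) B \<otimes>\<^sub>a ident C ?N = whisker [0] (whisker [] (move_left A x) B) [Suc r]"
    by (simp only: whisker_def W_ob)
  ultimately have split: "ident C ?M \<otimes>\<^sub>a left_term k ks \<otimes>\<^sub>a ident C ?N
      = (ident C ?M \<otimes>\<^sub>a (incl [x] \<otimes>\<^sub>a incl (A @ B)) \<otimes>\<^sub>a ident C ?N) \<cdot> whisker [0] (whisker [] (move_left A x) B) [Suc r]"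
    by (simp only:)
  have "(?ra \<otimes>\<^sub>a ident C (T n \<otimes>\<^sub>o ?N)) \<cdot> (ident C ?M \<otimes>\<^sub>a left_term k ks \<otimes>\<^sub>a ident C ?N)
    = (?ra \<otimes>\<^sub>a ident C (T n \<otimes>\<^sub>o ?N)) \<cdot> (ident C ?M \<otimes>\<^sub>a (incl [x] \<otimes>\<^sub>a incl (A @ B)) \<otimes>\<^sub>a ident C ?N) \<cdot>
      whisker [0] (whisker [] (move_left A x) B) [Suc r]"
    unfolding split ..
  also have "\<dots> = ((?ra \<otimes>\<^sub>a ident C (T n \<otimes>\<^sub>o ?N)) \<cdot> ((ident C ?M \<otimes>\<^sub>a incl [x]) \<otimes>\<^sub>a (incl (A @ B) \<otimes>\<^sub>a ident C ?N))) \<cdot>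
      whisker [0] (whisker [] (move_left A x) B) [Suc r]"
    using w ra by (simp add: cod_incl W_ob)
  also have "(?ra \<otimes>\<^sub>a ident C (T n \<otimes>\<^sub>o ?N)) \<cdot> ((ident C ?M \<otimes>\<^sub>a incl [x]) \<otimes>\<^sub>a (incl (A @ B) \<otimes>\<^sub>a ident C ?N))
    = rho x \<otimes>\<^sub>a (incl (A @ B) \<otimes>\<^sub>a ident C ?N)"
    using w ra by (subst tarr_interchange) (simp_all add: cod_incl right_action_incl[OF x])
  also have "\<dots> = summand (A @ B) \<cdot> whisker [] (rho x) (A @ B @ [Suc r])"
    using w by (simp add: summand_def whisker_def tarr_interchange W_ob cod_incl)
  also have "\<dots> \<cdot> whisker [0] (whisker [] (move_left A x) B) [Suc r] = summand (del k ks) \<cdot> del_right k ks"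
    using w by (simp add: kA del_def del_right_def act_right_def)
  finally show "(?ra \<otimes>\<^sub>a ident C (T n \<otimes>\<^sub>o ?N)) \<cdot> (ident C ?M \<otimes>\<^sub>a left_term k ks \<otimes>\<^sub>a ident C ?N)
    = summand (del k ks) \<cdot> del_right k ks" .
qed

lemma d_left_deletes: "deletes n (d_left n) del_left"
  unfolding d_left_def
proof (rule deletes_sandwich[where Z = "T n \<otimes>\<^sub>o T 1" and c = right_term])
  let ?M = "W 0" and ?N = "W (Suc r)" and ?la = "left_action C r T proj (W (Suc r)) lm"
  have la: "?la \<in> Arr C" "Dom C ?la = T 1 \<otimes>\<^sub>o ?N" "Cod C ?la = ?N"
    using left_action_hom by (simp_all add: Hom_def)
  then show "ident C (?M \<otimes>\<^sub>o T n) \<otimes>\<^sub>a ?la \<in> Arr C"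
    "Dom C (ident C (?M \<otimes>\<^sub>o T n) \<otimes>\<^sub>a ?la) = ?M \<otimes>\<^sub>o (T n \<otimes>\<^sub>o T 1) \<otimes>\<^sub>o ?N"
    "Cod C (ident C (?M \<otimes>\<^sub>o T n) \<otimes>\<^sub>a ?la) = MTN n"
    by (simp_all add: MTN_def)
  show "T n \<otimes>\<^sub>o T 1 \<in> Obj C" by simp
  show "shuffle_coproduct C r V \<tau> T incl proj n 1 \<in> Hom C (T (Suc n)) (T n \<otimes>\<^sub>o T 1)"
    by (rule coproduct_incl(1)[OF shuffles_one_right _ right_component right_term_hom]) simp_all
  fix ks assume ks: "ks \<in> ordered_words r (Suc n)"
  show "shuffle_coproduct C r V \<tau> T incl proj n 1 \<cdot> incl ks
      = arr_sum C (ob ks) (T n \<otimes>\<^sub>o T 1) (\<lambda>k. right_term k ks) {..<Suc n}"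
    by (rule coproduct_incl(2)[OF shuffles_one_right _ right_component right_term_hom]) (simp_all add: ks)
  fix k assume k: "k < Suc n"
  show "right_term k ks \<in> Hom C (ob ks) (T n \<otimes>\<^sub>o T 1)" by (rule right_term_hom[OF ks k])
  obtain A x B where kA: "ks = A @ x # B" "k = length A" "set (A @ x # B) \<subseteq> {1..r}"
     and w: "[x] \<in> ordered_words r 1" "A @ B \<in> ordered_words r n"
    using split_at[OF ks k] by metis
  have x: "x \<in> {1..r}" using kA(3) by simp
  have "right_term k ks = (incl (A @ B) \<otimes>\<^sub>a incl [x]) \<cdot> whisker A (move_right x B) []"
    by (simp add: right_term_def kA del_def)
  moreover have "ident C ?M \<otimes>\<^sub>a ((incl (A @ B) \<otimes>\<^sub>a incl [x]) \<cdot> whisker A (move_right x B) []) \<otimes>\<^sub>a ident C ?N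
      = (ident C ?M \<otimes>\<^sub>a (incl (A @ B) \<otimes>\<^sub>a incl [x]) \<otimes>\<^sub>a ident C ?N) \<cdot> (ident C ?M \<otimes>\<^sub>a whisker A (move_right x B) [] \<otimes>\<^sub>a ident C ?N)"
    by (rule sandwich_comp) (use w in simp_all)
  moreover have "ident C ?M \<otimes>\<^sub>a whisker A (move_right x B) [] \<otimes>\<^sub>a ident C ?N = whisker [0] (whisker A (move_right x B) []) [Suc r]"
    by (simp only: whisker_def W_ob)
  ultimately have split: "ident C ?M \<otimes>\<^sub>a right_term k ks \<otimes>\<^sub>a ident C ?N
      = (ident C ?M \<otimes>\<^sub>a (incl (A @ B) \<otimes>\<^sub>a incl [x]) \<otimes>\<^sub>a ident C ?N) \<cdot> whisker [0] (whisker A (move_right x B) []) [Suc r]"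
    by (simp only:)
  have "(ident C (?M \<otimes>\<^sub>o T n) \<otimes>\<^sub>a ?la) \<cdot> (ident C ?M \<otimes>\<^sub>a right_term k ks \<otimes>\<^sub>a ident C ?N)
    = (ident C (?M \<otimes>\<^sub>o T n) \<otimes>\<^sub>a ?la) \<cdot> (ident C ?M \<otimes>\<^sub>a (incl (A @ B) \<otimes>\<^sub>a incl [x]) \<otimes>\<^sub>a ident C ?N) \<cdot>
      whisker [0] (whisker A (move_right x B) []) [Suc r]"
    unfolding split ..
  also have "\<dots> = ((ident C (?M \<otimes>\<^sub>o T n) \<otimes>\<^sub>a ?la) \<cdot> ((ident C ?M \<otimes>\<^sub>a incl (A @ B)) \<otimes>\<^sub>a (incl [x] \<otimes>\<^sub>a ident C ?N))) \<cdot>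
      whisker [0] (whisker A (move_right x B) []) [Suc r]"
    using w la by (simp add: cod_incl W_ob)
  also have "(ident C (?M \<otimes>\<^sub>o T n) \<otimes>\<^sub>a ?la) \<cdot> ((ident C ?M \<otimes>\<^sub>a incl (A @ B)) \<otimes>\<^sub>a (incl [x] \<otimes>\<^sub>a ident C ?N))
    = (ident C ?M \<otimes>\<^sub>a incl (A @ B)) \<otimes>\<^sub>a lam x"
    using w la by (subst tarr_interchange) (simp_all add: cod_incl left_action_incl[OF x])
  also have "\<dots> = summand (A @ B) \<cdot> whisker (0 # A @ B) (lam x) []"
  proof -
    have "whisker (0 # A @ B) (lam x) [] = (ident C ?M \<otimes>\<^sub>a ident C (ob (A @ B))) \<otimes>\<^sub>a lam x"
      by (simp add: whisker_def ob_Cons[of 0])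
    moreover have "summand (A @ B) = (ident C ?M \<otimes>\<^sub>a incl (A @ B)) \<otimes>\<^sub>a ident C ?N"
      using w by (simp add: summand_def)
    moreover have "((ident C ?M \<otimes>\<^sub>a incl (A @ B)) \<otimes>\<^sub>a ident C ?N) \<cdot>
          ((ident C ?M \<otimes>\<^sub>a ident C (ob (A @ B))) \<otimes>\<^sub>a lam x)
        = (ident C ?M \<otimes>\<^sub>a incl (A @ B)) \<otimes>\<^sub>a lam x"
      using w by (simp add: tarr_interchange W_ob del: tarr_ident tarr_assoc)
    ultimately show ?thesis by simp
  qed
  also have "\<dots> \<cdot> whisker [0] (whisker A (move_right x B) []) [Suc r] = summand (del k ks) \<cdot> del_left k ks"
    using w by (simp add: kA del_def del_left_def act_left_def)
  finally show "(ident C (?M \<otimes>\<^sub>o T n) \<otimes>\<^sub>a ?la) \<cdot> (ident C ?M \<otimes>\<^sub>a right_term k ks \<otimes>\<^sub>a ident C ?N)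
    = summand (del k ks) \<cdot> del_left k ks" .
qed

lemma deletion_families: "deletion_family del_right" "deletion_family del_left"
  by (simp_all add: deletion_family_def del_right_hom del_left_hom)

lemma d_hom: "d_right n \<in> Hom C (MTN (Suc n)) (MTN n)" "d_left n \<in> Hom C (MTN (Suc n)) (MTN n)"
  using d_right_deletes d_left_deletes by (auto simp: deletes_def)

lemma d_right_square: "d_right n \<cdot> d_right (Suc n) = Zero C (MTN (Suc (Suc n))) (MTN n)"
  and d_left_square: "d_left n \<cdot> d_left (Suc n) = Zero C (MTN (Suc (Suc n))) (MTN n)"
  and d_commute: "d_left n \<cdot> d_right (Suc n) = d_right n \<cdot> d_left (Suc n)"
proof -
  show "d_right n \<cdot> d_right (Suc n) = Zero C (MTN (Suc (Suc n))) (MTN n)"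
    by (rule deletes_square_zero[OF d_right_deletes d_right_deletes deletion_families(1)])
      (rule del_right_del_right[where n = "Suc n"], auto simp: ordered_words_def)
  show "d_left n \<cdot> d_left (Suc n) = Zero C (MTN (Suc (Suc n))) (MTN n)"
    by (rule deletes_square_zero[OF d_left_deletes d_left_deletes deletion_families(2)])
      (rule del_left_del_left[where n = "Suc n"], auto simp: ordered_words_def)
  show "d_left n \<cdot> d_right (Suc n) = d_right n \<cdot> d_left (Suc n)"
    by (rule deletes_commute[OF d_left_deletes d_right_deletes d_right_deletes d_left_deletes
          deletion_families(2,1)])
      ((rule del_left_del_right[where n = "Suc n"] del_right_del_left[where n = "Suc n"];
        auto simp: ordered_words_def)+)
qed

end

section \<open>The bidifferential\<close>

theorem theorem3p7:
  fixes C :: "('o, 'm) moncat"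
    and r :: nat
    and V :: "nat \<Rightarrow> 'o" and \<sigma> :: "nat \<Rightarrow> nat \<Rightarrow> 'm"
    and M :: 'o and \<rho> :: "nat \<Rightarrow> 'm"
    and N :: 'o and lam :: "nat \<Rightarrow> 'm"
    and T :: "nat \<Rightarrow> 'o" and incl proj :: "nat list \<Rightarrow> 'm"
  assumes "additive_monoidal_category C"
    and "braided_system C r V \<sigma>"
    and "right_module C r V \<sigma> M \<rho>"
    and "left_module C r V \<sigma> N lam"
    and "ordered_tensor_powers C r V T incl proj"
  shows "bidifferential C (\<lambda>n. tobj C M (tobj C (T n) N))
           (right_differential C r V \<sigma> T incl proj M \<rho> N)
           (left_differential C r V \<sigma> T incl proj M N lam)"
proof -
  interpret additive_monoidal_category C by fact
  have M: "M \<in> Obj C" and N: "N \<in> Obj C"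
    using assms(3,4) by (auto simp: right_module_def left_module_def)
  have V: "V i \<in> Obj C" if "1 \<le> i" "i \<le> r" for i
    using assms(2) that by (simp add: braided_system_def)
  \<comment> \<open>every index beyond \<open>r\<close> is given the value \<open>N\<close>, so that all letters are objects\<close>
  define W where "W k = (if k = 0 then M else if k \<le> r then V k else N)" for k
  interpret word_objects C W
    by unfold_locales (auto simp: W_def M N V)
  have W0: "W 0 = M" and WN: "W (Suc r) = N" by (simp_all add: W_def)
  have WV: "W i = V i" if "1 \<le> i" "i \<le> r" for i using that by (simp add: W_def)
  define \<tau> where "\<tau> = neg_braiding C V \<sigma>"
  define t where "t i j = (if 1 \<le> i \<and> i \<le> j \<and> j \<le> r then \<tau> i j else Zero C (ob [i, j]) (ob [j, i]))" for i j
  define rho where "rho i = (if i \<in> {1..r} then \<rho> i else Zero C (ob [0, i]) (ob [0]))" for i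
  define lm where "lm i = (if i \<in> {1..r} then lam i else Zero C (ob [i, Suc r]) (ob [Suc r]))" for i
  have ob2: "ob [i, j] = W i \<otimes>\<^sub>o\<^bsub>C\<^esub> W j" for i j by (simp add: ob_Cons)
  have s: "\<sigma> i j \<in> Arr C" "Dom C (\<sigma> i j) = ob [i, j]" "Cod C (\<sigma> i j) = ob [j, i]"
    if "1 \<le> i" "i \<le> j" "j \<le> r" for i j
    using assms(2) that WV[of i] WV[of j] by (auto simp: braided_system_def Hom_def ob2)
  have t: "t i j = neg (\<sigma> i j)" if "1 \<le> i" "i \<le> j" "j \<le> r" for i j
    using s[OF that] that WV[of i] WV[of j] by (simp add: t_def \<tau>_def neg_braiding_def neg_def ob2)
  have rh: "rho i \<in> Arr C" "Dom C (rho i) = ob [0, i]" "Cod C (rho i) = ob [0]" for i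
    using assms(3) WV[of i] by (auto simp: rho_def right_module_def Hom_def ob2 W0 ob_Cons)
  have lh: "lm i \<in> Arr C" "Dom C (lm i) = ob [i, Suc r]" "Cod C (lm i) = ob [Suc r]" for i
    using assms(4) WV[of i] by (auto simp: lm_def left_module_def Hom_def ob2 WN ob_Cons)
  interpret bidifferential_data C W r t rho lm V \<tau> \<rho> lam T incl proj
  proof unfold_locales
    fix i j k
    show "t i j \<in> Hom C (ob [i, j]) (ob [j, i])"
      using s[of i j] t[of i j] by (cases "1 \<le> i \<and> i \<le> j \<and> j \<le> r") (auto simp: Hom_def t_def)
    show "rho i \<in> Hom C (ob [0, i]) (ob [0])" "lm i \<in> Hom C (ob [i, Suc r]) (ob [Suc r])"
      using rh lh by (simp_all add: Hom_def)
    show "k \<in> {1..r} \<Longrightarrow> V k = W k" using WV by simp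
    show "\<lbrakk>1 \<le> i; i \<le> j; j \<le> r\<rbrakk> \<Longrightarrow> \<tau> i j = t i j" by (simp add: t_def)
    show "i \<in> {1..r} \<Longrightarrow> \<rho> i = rho i" "i \<in> {1..r} \<Longrightarrow> lam i = lm i"
      by (simp_all add: rho_def lm_def)
    show "ordered_tensor_powers C r V T incl proj" by fact
    show "comp C (whisker [] (t j k) [i]) (comp C (whisker [j] (t i k) []) (whisker [] (t i j) [k])) =
      comp C (whisker [k] (t i j) []) (comp C (whisker [] (t i k) [j]) (whisker [i] (t j k) []))"
      if ijk: "1 \<le> i" "i \<le> j" "j \<le> k" "k \<le> r"
    proof -
      have "comp C (tarr C (\<sigma> j k) (ident C (V i))) (comp C (tarr C (ident C (V j)) (\<sigma> i k)) (tarr C (\<sigma> i j) (ident C (V k))))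
       = comp C (tarr C (ident C (V k)) (\<sigma> i j)) (comp C (tarr C (\<sigma> i k) (ident C (V j))) (tarr C (ident C (V i)) (\<sigma> j k)))"
        using assms(2) ijk by (simp add: braided_system_def)
      then have "comp C (whisker [] (\<sigma> j k) [i]) (comp C (whisker [j] (\<sigma> i k) []) (whisker [] (\<sigma> i j) [k])) =
      comp C (whisker [k] (\<sigma> i j) []) (comp C (whisker [] (\<sigma> i k) [j]) (whisker [i] (\<sigma> j k) []))"
        using ijk s V by (simp add: whisker_def WV flip: W_ob)
      then show ?thesis using ijk s by (simp add: t)
    qed
    show "comp C (rho j) (whisker [] (rho i) [j]) =
        neg (comp C (rho i) (comp C (whisker [] (rho j) [i]) (whisker [0] (t i j) [])))"
      if ij: "1 \<le> i" "i \<le> j" "j \<le> r"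
    proof -
      have "comp C (\<rho> j) (tarr C (\<rho> i) (ident C (V j))) =
        comp C (\<rho> i) (comp C (tarr C (\<rho> j) (ident C (V i))) (tarr C (ident C M) (\<sigma> i j)))"
        using assms(3) ij by (simp add: right_module_def)
      then have "comp C (rho j) (whisker [] (rho i) [j]) =
        comp C (rho i) (comp C (whisker [] (rho j) [i]) (whisker [0] (\<sigma> i j) []))"
        using ij s V M rh[of i] rh[of j] by (simp add: whisker_def WV W0 rho_def flip: W_ob)
      then show ?thesis using ij s rh by (simp add: t)
    qed
    show "comp C (lm i) (whisker [i] (lm j) []) =
        neg (comp C (lm j) (comp C (whisker [j] (lm i) []) (whisker [] (t i j) [Suc r])))"
      if ij: "1 \<le> i" "i \<le> j" "j \<le> r"
    proof -
      have "comp C (lam i) (tarr C (ident C (V i)) (lam j)) =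
        comp C (lam j) (comp C (tarr C (ident C (V j)) (lam i)) (tarr C (\<sigma> i j) (ident C N)))"
        using assms(4) ij by (simp add: left_module_def)
      then have "comp C (lm i) (whisker [i] (lm j) []) =
        comp C (lm j) (comp C (whisker [j] (lm i) []) (whisker [] (\<sigma> i j) [Suc r]))"
        using ij s V N lh[of i] lh[of j] by (simp add: whisker_def WV WN lm_def flip: W_ob)
      then show ?thesis using ij s lh by (simp add: t)
    qed
  qed
  have MTN: "MTN n = tobj C M (tobj C (T n) N)" for n by (simp add: MTN_def W0 WN)
  have right: "right_differential C r V \<sigma> T incl proj M \<rho> N (Suc n) = d_right n" for n
    by (simp add: right_differential_def d_right_def W0 WN flip: \<tau>_def)
  have left: "left_differential C r V \<sigma> T incl proj M N lam (Suc n)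
      = (if even n then d_left n else neg (d_left n))" for n
    using scale_sign[of "d_left n" n] d_hom(2)[of n]
    by (simp add: left_differential_def d_left_def W0 WN Hom_def MTN flip: \<tau>_def)
  have typed: "d_right n \<in> Arr C" "Dom C (d_right n) = MTN (Suc n)" "Cod C (d_right n) = MTN n"
    "d_left n \<in> Arr C" "Dom C (d_left n) = MTN (Suc n)" "Cod C (d_left n) = MTN n" for n
    using d_hom[of n] by (simp_all add: Hom_def)
  show ?thesis
    unfolding bidifferential_def MTN[symmetric]
  proof (intro conjI allI impI)
    fix n :: nat assume "1 \<le> n"
    then obtain m where n: "n = Suc m" by (cases n) auto
    show "right_differential C r V \<sigma> T incl proj M \<rho> N n \<in> Hom C (MTN n) (MTN (n - 1))"
      "left_differential C r V \<sigma> T incl proj M N lam n \<in> Hom C (MTN n) (MTN (n - 1))"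
      by (simp_all add: n right left Hom_def typed)
  next
    fix n :: nat assume "1 < n"
    then obtain m where n: "n = Suc (Suc m)" by (metis One_nat_def less_imp_Suc_add add_Suc_right plus_1_eq_Suc)
    have n1: "n - 1 = Suc m" and n2: "n - 2 = m" by (simp_all add: n)
    let ?d = "right_differential C r V \<sigma> T incl proj M \<rho> N" and ?d' = "left_differential C r V \<sigma> T incl proj M N lam"
    show "comp C (?d (n - 1)) (?d n) = Zero C (MTN n) (MTN (n - 2))"
      unfolding n1 n2 unfolding n by (simp add: right d_right_square)
    show "comp C (?d' (n - 1)) (?d' n) = Zero C (MTN n) (MTN (n - 2))"
      unfolding n1 n2 unfolding n by (simp add: left d_left_square typed)
    show "Add C (comp C (?d' (n - 1)) (?d n)) (comp C (?d (n - 1)) (?d' n)) = Zero C (MTN n) (MTN (n - 2))"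
      unfolding n1 n2 unfolding n by (simp add: left right typed d_commute)
  qed
qed

end
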